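(* Let $G$ be a connected graph on $n$ vertices, let $1\le k\le n$, let $\vec\phi_k$ be any eigenvector of the $1$-Laplacian of $G$ with eigenvalue $c_k$, and let $r=\gamma(\mathcal K_{c_k})$ be the topological multiplicity of $c_k$. Then $$S(\vec\phi_k)\le k+r-1.$$
   Context: $G=(V,E)$ is a finite simple undirected connected graph, $V=\{1,\dots,n\}$, $n\ge 2$; $d_i$ is the degree of $i$. $\mathrm{Sgn}(t)=\{1\}$ if $t>0$, $\{-1\}$ if $t<0$, $[-1,1]$ if $t=0$. $I(\vec x)=\sum_{\{i,j\}\in E}|x_i-x_j|$ and $X=\{\vec x\in\mathbb R^n:\sum_i d_i|x_i|=1\}$. A nonzero $\vec x\in\mathbb R^n$ is an eigenvector of the $1$-Laplacian with eigenvalue $\mu$ if there exist $z_{ij}\in\mathrm{Sgn}(x_i-x_j)$ with $z_{ji}=-z_{ij}$ (for all adjacent $i,j$) such that $\sum_{j\sim i}z_{ij}\in\mu d_i\,\mathrm{Sgn}(x_i)$ for all $i\in V$. $\mathcal K_\mu$ is the set of eigenvectors in $X$ with eigenvalue $\mu$. For a closed symmetric set $A\subset\mathbb R^n\setminus\{0\}$ ($A=-A$), $\gamma(A)$ is the Krasnoselskii genus: the least integer $m\ge 0$ for which there is an odd continuous map $A\to\mathbb R^m\setminus\{0\}$ ($\gamma(\emptyset)=0$). The minimax values are $c_k=\inf_{\gamma(A)\ge k}\max_{\vec x\in A}I(\vec x)$, the infimum over closed symmetric $A\subset X$; each $c_k$ is an eigenvalue of the $1$-Laplacian (known), and $c_1\le\dots\le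 c_n$. It is also known (Liusternik–Schnirelmann) that $c_{k+1}=\dots=c_{k+l}=c$ implies $\gamma(\mathcal K_c)\ge l$. The (strong) nodal domains of $\vec x$ are the vertex sets of the connected components of the subgraphs induced on $\{i:x_i>0\}$ and on $\{i:x_i<0\}$; $S(\vec x)$ is the total number of them. *)

theory Defs
  imports "HOL-Analysis.Analysis"
begin

text \<open>
  A finite simple undirected graph is a symmetric irreflexive relation \<open>E\<close> on the finite
  vertex type \<open>'n\<close>; every edge \<open>{i,j}\<close> occurs in \<open>E\<close> as the two pairs \<open>(i,j)\<close> and \<open>(j,i)\<close>.
\<close>

definition connected_graph :: "('n::finite) rel \<Rightarrow> bool"
  where "connected_graph E \<longleftrightarrow> sym E \<and> irrefl E \<and> (\<forall>i j. (i, j) \<in> E\<^sup>*)"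

definition vertex_degree :: "('n::finite) rel \<Rightarrow> 'n \<Rightarrow> nat"
  where "vertex_degree E i = card {j. (i, j) \<in> E}"

definition Sgn :: "real \<Rightarrow> real set"
  where "Sgn t = (if t > 0 then {1} else if t < 0 then {-1} else {-1..1})"

text \<open>Halved, because the sum over \<open>E\<close> meets each undirected edge twice.\<close>

definition tv :: "('n::finite) rel \<Rightarrow> real ^ 'n \<Rightarrow> real"
  where "tv E x = (\<Sum>(i, j)\<in>E. \<bar>x $ i - x $ j\<bar>) / 2"

definition X_set :: "('n::finite) rel \<Rightarrow> (real ^ 'n) set"
  where "X_set E = {x. (\<Sum>i\<in>UNIV. real (vertex_degree E i) * \<bar>x $ i\<bar>) = 1}"

definition one_laplacian_eigenvector :: "('n::finite) rel \<Rightarrow> real \<Rightarrow> real ^ 'n \<Rightarrow> bool"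
  where "one_laplacian_eigenvector E \<mu> x \<longleftrightarrow> x \<noteq> 0 \<and>
    (\<exists>z :: 'n \<Rightarrow> 'n \<Rightarrow> real.
      (\<forall>i j. (i, j) \<in> E \<longrightarrow> z i j \<in> Sgn (x $ i - x $ j) \<and> z j i = - z i j) \<and>
      (\<forall>i. (\<Sum>j | (i, j) \<in> E. z i j) \<in> (\<lambda>s. \<mu> * real (vertex_degree E i) * s) ` Sgn (x $ i)))"

definition eigenset :: "('n::finite) rel \<Rightarrow> real \<Rightarrow> (real ^ 'n) set"
  where "eigenset E \<mu> = {x \<in> X_set E. one_laplacian_eigenvector E \<mu> x}"

definition closed_symmetric :: "(real ^ 'n::finite) set \<Rightarrow> bool"
  where "closed_symmetric A \<longleftrightarrow> closed A \<and> uminus ` A = A"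

text \<open>
  Krasnoselskii genus, meant for closed symmetric sets not containing \<open>0\<close>. There the set of
  admissible \<open>m\<close> is nonempty: the identity provides \<open>m = CARD('n)\<close>. The dimension of the target
  varies, so it is the library space of sequences vanishing from index \<open>m\<close> on. For \<open>m = 0\<close> that
  space is \<open>{0}\<close>, so the genus of \<open>{}\<close>, and of no other such set, is \<open>0\<close>.
\<close>

definition genus :: "(real ^ 'n::finite) set \<Rightarrow> nat"
  where "genus A = (LEAST m. \<exists>f :: real ^ 'n \<Rightarrow> nat \<Rightarrow> real.
    continuous_map (top_of_set A) (Euclidean_space m) f \<and>
    (\<forall>x\<in>A. f (- x) = (\<lambda>i. - f x i)) \<and>
    (\<forall>x\<in>A. f x \<noteq> (\<lambda>i. 0)))"

text \<open>
  For a connected graph on at least two vertices \<open>X_set E\<close> is compact, so for \<open>k \<ge> 1\<close> every admissible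
  \<open>A\<close> is compact and nonempty and the supremum over \<open>A\<close> is a maximum. For \<open>k \<le> CARD('n)\<close> there is
  an admissible \<open>A\<close>, namely \<open>X_set E\<close> (Borsuk-Ulam), so the infimum is a genuine one.
\<close>

definition minimax :: "('n::finite) rel \<Rightarrow> nat \<Rightarrow> real"
  where "minimax E k =
    (INF A \<in> {A. closed_symmetric A \<and> A \<subseteq> X_set E \<and> k \<le> genus A}. SUP x\<in>A. tv E x)"

text \<open>Vertex sets of the connected components of the subgraph induced on \<open>W\<close>.\<close>

definition components_on :: "('n::finite) rel \<Rightarrow> 'n set \<Rightarrow> 'n set set"
  where "components_on E W = {(E \<inter> W \<times> W)\<^sup>* `` {v} | v. v \<in> W}"

definition nodal_domains :: "('n::finite) rel \<Rightarrow> real ^ 'n \<Rightarrow> 'n set set"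
  where "nodal_domains E x = components_on E {i. x $ i > 0} \<union> components_on E {i. x $ i < 0}"

end

theory Submission
  imports Defs "HOL-Homology.Homology"
begin

text \<open>
  Write \<open>c = c\<^sub>k\<close> and let \<open>m\<close> be the number of nodal domains of \<open>\<phi>\<close>. On the \<open>m\<close>-dimensional space of
  vectors that are constant on each nodal domain and vanish where \<open>\<phi>\<close> does, the total variation is at
  most \<open>c\<close> times the degree norm. So a sphere of dimension \<open>m - 1\<close> maps oddly into the sublevel set
  \<open>{I \<le> c}\<close> of \<open>X\<close>. Suppose \<open>m \<ge> k + r\<close>. Extend an odd nonvanishing map from the eigenset to \<open>\<real>\<^sup>r\<close> oddly to
  the whole space; by Borsuk-Ulam its zero set within the sublevel set has genus at least \<open>m - r \<ge> k\<close>,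
  and it contains no eigenvector for \<open>c\<close>. Away from eigenvectors the subdifferentials of \<open>I\<close> and of
  \<open>c\<close> times the degree norm can be strictly separated, which gives an odd deformation of the zero set
  to levels strictly below \<open>c\<close>, against the definition of \<open>c\<^sub>k\<close>.

  Borsuk-Ulam is proved by Ky Fan's parity argument on subdivided singular chains \<open>h\<^sub>i\<close> of the sphere
  with \<open>\<partial> h\<^sub>i = \<nu> h\<^sub>i\<^sub>-\<^sub>1 \<plusminus> h\<^sub>i\<^sub>-\<^sub>1\<close>, where \<open>\<nu>\<close> is the antipodal map. They exist since the \<open>n\<close>-sphere has
  no reduced homology below degree \<open>n\<close>. A vertex is labelled by the index and the sign of a largest coordinate of its
  image; parity forces a simplex with more distinct labels than there are coordinates.
\<close>

subsection \<open>Alternating labellings\<close>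

fun alternating :: "bool \<Rightarrow> bool list \<Rightarrow> bool" where
  "alternating t [] \<longleftrightarrow> True"
| "alternating t (x # xs) \<longleftrightarrow> x = t \<and> alternating (\<not> t) xs"

text \<open>The parity core of Ky Fan's argument. Deleting the head leaves \<open>xs\<close>; any
  other deletion keeps \<open>x\<close> in front, so it alternates from \<open>t\<close> exactly
  when \<open>s x = t\<close> and the shortened tail alternates from \<open>\<not> t\<close>. The
  induction hypothesis for the opposite sign then settles both cases of \<open>s x\<close>.\<close>

lemma even_alternating_deletions:
  assumes "distinct xs"
  shows "even (card {i \<in> set xs. alternating t (map s (remove1 i xs))}
    + of_bool (alternating t (map s xs)) + of_bool (alternating (\<not> t) (map s xs)))"
  using assms
proof (induction xs arbitrary: t)
  case (Cons x xs)
  let ?D = "\<lambda>t. {i \<in> set xs. alternating t (map s (remove1 i xs))}"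
  have "{i \<in> set (x # xs). alternating t (map s (remove1 i (x # xs)))}
      = (if alternating t (map s xs) then {x} else {}) \<union> (if s x = t then ?D (\<not> t) else {})"
    using Cons.prems by (auto split: if_splits)
  moreover have "x \<notin> ?D (\<not> t)"
    using Cons.prems by auto
  ultimately have "card {i \<in> set (x # xs). alternating t (map s (remove1 i (x # xs)))}
      = of_bool (alternating t (map s xs)) + (if s x = t then card (?D (\<not> t)) else 0)"
    by auto
  then show ?case
    using Cons.IH[of "\<not> t"] Cons.prems by (cases "s x = t") auto
qed auto

text \<open>A label is an index with a sign. The cardinality condition discards simplices with
  repeated labels. Reading the sign of \<open>i\<close> off \<open>(i, True) \<in> L\<close> is
  faithful when no index occurs with both signs, which injectivity of \<open>fst\<close> guarantees
  below.\<close>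

definition alternating_labels :: "bool \<Rightarrow> nat \<Rightarrow> (nat \<times> bool) set \<Rightarrow> bool" where
  "alternating_labels t q L \<longleftrightarrow>
    card L = q \<and> alternating t (map (\<lambda>i. (i, True) \<in> L) (sorted_list_of_set (fst ` L)))"

text \<open>With distinct labels this is the deletion parity for the sorted indices. A repeated
  label leaves too few labels for the full simplex; at most the two facets opposite the repeated
  vertices can then count, and these carry the same labels, so they cancel modulo 2.\<close>

lemma even_alternating_facets:
  fixes l :: "nat \<Rightarrow> nat \<times> bool"
  assumes good: "inj_on fst (l ` {..p})"
  shows "even (card {k \<in> {..p}. alternating_labels t p (l ` ({..p} - {k}))}
    + of_bool (alternating_labels t (Suc p) (l ` {..p}))
    + of_bool (alternating_labels (\<not> t) (Suc p) (l ` {..p})))"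
proof (cases "inj_on l {..p}")
  case True
  define f where "f = fst \<circ> l"
  define xs where "xs = sorted_list_of_set (f ` {..p})"
  define s where "s = (\<lambda>i. (i, True) \<in> l ` {..p})"
  have xs: "set xs = f ` {..p}" "distinct xs"
    by (simp_all add: xs_def)
  have inj: "inj_on f {..p}"
    unfolding f_def using True good by (rule comp_inj_on)
  have card_L: "card (l ` {..p}) = Suc p"
    using True by (simp add: card_image)
  have facet: "alternating_labels t p (l ` ({..p} - {k})) \<longleftrightarrow> alternating t (map s (remove1 (f k) xs))"
    if "k \<in> {..p}" for k
  proof -
    have "card (l ` ({..p} - {k})) = p"
      using that True by (subst card_image) (auto intro: inj_on_diff)
    moreover have "fst ` l ` ({..p} - {k}) = f ` {..p} - {f k}"
      using inj_on_image_set_diff[OF inj, of "{..p}" "{k}"] that by (simp add: image_comp f_def)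
    then have "sorted_list_of_set (fst ` l ` ({..p} - {k})) = remove1 (f k) xs"
      by (simp add: xs_def sorted_list_of_set_remove)
    moreover have "(i, True) \<in> l ` ({..p} - {k}) \<longleftrightarrow> s i" if "i \<noteq> f k" for i
    proof
      assume "s i"
      then obtain j where j: "j \<in> {..p}" "(i, True) = l j"
        unfolding s_def by blast
      have "j \<noteq> k"
        using that j(2) unfolding f_def by (metis comp_apply fst_conv)
      with j show "(i, True) \<in> l ` ({..p} - {k})" by blast
    qed (auto simp: s_def)
    then have "map (\<lambda>i. (i, True) \<in> l ` ({..p} - {k})) (remove1 (f k) xs) = map s (remove1 (f k) xs)"
      using xs(2) by (intro map_cong refl) simp
    ultimately show ?thesis
      by (simp only: alternating_labels_def simp_thms)
  qed
  have "card {k \<in> {..p}. alternating_labels t p (l ` ({..p} - {k}))}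
      = card {k \<in> {..p}. alternating t (map s (remove1 (f k) xs))}"
    by (intro arg_cong[where f = card] Collect_cong conj_cong refl facet)
  also have "\<dots> = card (f ` {k \<in> {..p}. alternating t (map s (remove1 (f k) xs))})"
    by (intro card_image[symmetric] inj_on_subset[OF inj] Collect_restrict)
  also have "f ` {k \<in> {..p}. alternating t (map s (remove1 (f k) xs))}
      = {i \<in> set xs. alternating t (map s (remove1 i xs))}"
    unfolding xs by blast
  finally have 1: "card {k \<in> {..p}. alternating_labels t p (l ` ({..p} - {k}))}
      = card {i \<in> set xs. alternating t (map s (remove1 i xs))}" .
  have 2: "alternating_labels t' (Suc p) (l ` {..p}) \<longleftrightarrow> alternating t' (map s xs)" for t'
    unfolding alternating_labels_def s_def xs_def f_def image_comp using card_L by simp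
  show ?thesis
    unfolding 1 2 by (rule even_alternating_deletions[OF xs(2)])
next
  case False
  then obtain a b where ab: "a \<le> p" "b \<le> p" "a \<noteq> b" "l a = l b"
    by (auto simp: inj_on_def)
  let ?L = "l ` {..p}"
  have le: "card ?L \<le> p"
  proof -
    have "card ?L \<noteq> card {..p}"
      using False eq_card_imp_inj_on by blast
    moreover have "card ?L \<le> card {..p}"
      by (rule card_image_le) simp
    ultimately show ?thesis by simp
  qed
  show ?thesis
  proof (cases "card ?L = p")
    case False
    have "card (l ` ({..p} - {k})) \<noteq> p" for k
    proof -
      have "card (l ` ({..p} - {k})) \<le> card ?L"
        by (intro card_mono) auto
      then show ?thesis using False le by linarith
    qed
    then show ?thesis
      using le by (simp add: alternating_labels_def)
  next
    case cL: True
    have drop: "l ` ({..p} - {c}) = ?L" if "c \<le> p" "d \<le> p" "c \<noteq> d" "l c = l d" for c d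
    proof -
      have "?L = insert (l c) (l ` ({..p} - {c}))"
        using that(1) by blast
      moreover have "l c \<in> l ` ({..p} - {c})"
        using that by auto
      ultimately show ?thesis by auto
    qed
    have rm: "l ` ({..p} - {a}) = ?L" "l ` ({..p} - {b}) = ?L"
      using drop[of a b] drop[of b a] ab by metis+
    have ne: "card (l ` ({..p} - {k})) \<noteq> p" if "k \<le> p" "k \<noteq> a" "k \<noteq> b" for k
    proof
      assume "card (l ` ({..p} - {k})) = p"
      then have "inj_on l ({..p} - {k})"
        using that by (intro eq_card_imp_inj_on) auto
      then show False
        using ab that by (auto simp: inj_on_def)
    qed
    have "alternating_labels t p (l ` ({..p} - {k})) \<longleftrightarrow> k \<in> {a, b} \<and> alternating_labels t p ?L"
      if "k \<in> {..p}" for k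
      using that
    proof (cases "k \<in> {a, b}")
      case True
      then have "l ` ({..p} - {k}) = ?L" using rm by blast
      then show ?thesis using True by (simp only: simp_thms)
    next
      case False
      then show ?thesis using that ne[of k] unfolding alternating_labels_def by blast
    qed
    then have "{k \<in> {..p}. alternating_labels t p (l ` ({..p} - {k}))}
        = {k \<in> {..p}. k \<in> {a, b} \<and> alternating_labels t p ?L}"
      by (intro Collect_cong conj_cong refl)
    also have "\<dots> = (if alternating_labels t p ?L then {a, b} else {})"
      using ab(1,2) by auto
    finally have "even (card {k \<in> {..p}. alternating_labels t p (l ` ({..p} - {k}))})"
      using ab(3) by simp
    moreover have "\<not> alternating_labels t' (Suc p) ?L" for t'
      unfolding alternating_labels_def cL by simp
    ultimately show ?thesis
      by simp
  qed
qed

subsection \<open>Alternating simplices of a singular chain\<close>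

text \<open>The homomorphism from the free abelian group to the integers with value
  \<open>w a\<close> on the generator \<open>a\<close>.\<close>

definition weight :: "('a \<Rightarrow> int) \<Rightarrow> ('a \<Rightarrow>\<^sub>0 int) \<Rightarrow> int" where
  "weight w c = (\<Sum>a\<in>Poly_Mapping.keys c. Poly_Mapping.lookup c a * w a)"

lemma weight_superset:
  assumes "finite S" "Poly_Mapping.keys c \<subseteq> S"
  shows "weight w c = (\<Sum>a\<in>S. Poly_Mapping.lookup c a * w a)"
  unfolding weight_def using assms
  by (intro sum.mono_neutral_left) (auto simp: in_keys_iff)

lemma weight_add: "weight w (c + d) = weight w c + weight w d"
proof -
  let ?S = "Poly_Mapping.keys c \<union> Poly_Mapping.keys d"
  have "Poly_Mapping.keys (c + d) \<subseteq> ?S"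
    by (rule keys_add)
  then show ?thesis
    by (simp add: weight_superset[of ?S] lookup_add distrib_right sum.distrib)
qed

lemma weight_0 [simp]: "weight w 0 = 0"
  by (simp add: weight_def)

lemma weight_cmul: "weight w (frag_cmul n c) = n * weight w c"
proof -
  have "Poly_Mapping.keys (frag_cmul n c) \<subseteq> Poly_Mapping.keys c"
    by (rule keys_cmul)
  then show ?thesis
    by (simp add: weight_superset[of "Poly_Mapping.keys c"] sum_distrib_left mult.assoc)
qed

lemma weight_of [simp]: "weight w (frag_of a) = w a"
  by (simp add: weight_def)

lemma weight_sum: "weight w (sum f I) = (\<Sum>i\<in>I. weight w (f i))"
  by (induction I rule: infinite_finite_induct) (auto simp: weight_add)

lemma weight_extend: "weight w (frag_extend b c) = weight (\<lambda>a. weight w (b a)) c"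
  by (simp add: frag_extend_def weight_sum weight_cmul weight_def[of _ c])

abbreviation simplex_labels :: "('a \<Rightarrow> nat \<times> bool) \<Rightarrow> nat \<Rightarrow> ((nat \<Rightarrow> real) \<Rightarrow> 'a) \<Rightarrow> (nat \<times> bool) set" where
  "simplex_labels lab p \<sigma> \<equiv> (\<lambda>k. lab (simplicial_vertex k \<sigma>)) ` {..p}"

text \<open>Integer multiplicities make the count additive on chains; what matters in the end is its
  parity.\<close>

definition alternating_count :: "('a \<Rightarrow> nat \<times> bool) \<Rightarrow> bool \<Rightarrow> nat \<Rightarrow> 'a chain \<Rightarrow> int" where
  "alternating_count lab t p =
    weight (\<lambda>\<sigma>. of_bool (alternating_labels t (Suc p) (simplex_labels lab p \<sigma>)))"

lemma simplicial_vertex_singular_face: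
  assumes "j \<le> p"
  shows "simplicial_vertex j (singular_face (Suc p) k \<sigma>) = simplicial_vertex (if j < k then j else Suc j) \<sigma>"
proof -
  have "simplical_face k (\<lambda>i. if i = j then 1 else 0 :: real)
      = (\<lambda>i. if i = (if j < k then j else Suc j) then 1 else 0)"
    by (auto simp: simplical_face_def fun_eq_iff)
  then show ?thesis
    using assms by (simp add: simplicial_vertex_def singular_face_def)
qed

lemma simplex_labels_singular_face:
  assumes "k \<le> Suc p"
  shows "simplex_labels lab p (singular_face (Suc p) k \<sigma>)
    = (\<lambda>k. lab (simplicial_vertex k \<sigma>)) ` ({..Suc p} - {k})"
proof -
  have "(\<lambda>j. if j < k then j else Suc j) ` {..p} = {..Suc p} - {k}"
  proof (intro equalityI subsetI)
    fix i assume i: "i \<in> {..Suc p} - {k}"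
    show "i \<in> (\<lambda>j. if j < k then j else Suc j) ` {..p}"
    proof (cases "i < k")
      case True
      then show ?thesis using assms by (intro image_eqI[of _ _ i]) auto
    next
      case False
      then show ?thesis using i by (intro image_eqI[of _ _ "i - 1"]) auto
    qed
  qed auto
  then show ?thesis
    by (simp add: simplicial_vertex_singular_face flip: image_image[of "\<lambda>k. lab (simplicial_vertex k \<sigma>)" "\<lambda>j. if j < k then j else Suc j"])
qed

lemma even_weight:
  assumes "\<And>a. a \<in> Poly_Mapping.keys c \<Longrightarrow> even (u a + v a + w a)"
  shows "even (weight u c + weight v c + weight w c)"
proof -
  have "weight u c + weight v c + weight w c
      = (\<Sum>a\<in>Poly_Mapping.keys c. Poly_Mapping.lookup c a * (u a + v a + w a))"
    by (simp add: weight_def sum.distrib distrib_left)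
  also have "even \<dots>"
    using assms by (intro dvd_sum dvd_mult) auto
  finally show ?thesis .
qed

text \<open>Modulo 2 the boundary signs disappear, so a signed sum over facets can be traded for a
  number of facets.\<close>

lemma even_signed_card:
  "even ((\<Sum>k\<le>p. (-1) ^ k * of_bool (P k)) + int (card {k \<in> {..p}. P k}))"
proof -
  have "int (card {k \<in> {..p}. P k}) = (\<Sum>k\<le>p. of_bool (P k))"
    by (simp add: of_bool_def sum.If_cases Int_def)
  then have "(\<Sum>k\<le>p. (-1) ^ k * of_bool (P k)) + int (card {k \<in> {..p}. P k})
      = (\<Sum>k\<le>p. ((-1) ^ k + 1) * of_bool (P k))"
    by (simp add: sum.distrib distrib_right)
  also have "even \<dots>"
    by (intro dvd_sum dvd_mult2) auto
  finally show ?thesis .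
qed

text \<open>The linear extension of \<open>even_alternating_facets\<close>, applied to one simplex
  of \<open>c\<close> at a time.\<close>

lemma even_alternating_count_boundary:
  assumes "\<And>\<sigma>. \<sigma> \<in> Poly_Mapping.keys c \<Longrightarrow> inj_on fst (simplex_labels lab (Suc p) \<sigma>)"
  shows "even (alternating_count lab t p (chain_boundary (Suc p) c)
    + alternating_count lab t (Suc p) c + alternating_count lab (\<not> t) (Suc p) c)"
proof -
  have "even (weight (\<lambda>\<sigma>. of_bool (alternating_labels t (Suc p) (simplex_labels lab p \<sigma>)))
        (\<Sum>k\<le>Suc p. frag_cmul ((-1) ^ k) (frag_of (singular_face (Suc p) k \<sigma>)))
      + of_bool (alternating_labels t (Suc (Suc p)) (simplex_labels lab (Suc p) \<sigma>))
      + of_bool (alternating_labels (\<not> t) (Suc (Suc p)) (simplex_labels lab (Suc p) \<sigma>)))"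
    if "\<sigma> \<in> Poly_Mapping.keys c" for \<sigma>
  proof -
    let ?l = "\<lambda>k. lab (simplicial_vertex k \<sigma>)"
    let ?P = "\<lambda>k. alternating_labels t (Suc p) (?l ` ({..Suc p} - {k}))"
    have "weight (\<lambda>\<sigma>. of_bool (alternating_labels t (Suc p) (simplex_labels lab p \<sigma>)))
        (\<Sum>k\<le>Suc p. frag_cmul ((-1) ^ k) (frag_of (singular_face (Suc p) k \<sigma>)))
       = (\<Sum>k\<le>Suc p. (-1) ^ k * of_bool (?P k))"
      unfolding weight_sum weight_cmul weight_of
      by (intro sum.cong refl arg_cong2[where f = "(*)"] arg_cong[where f = of_bool]
          arg_cong[where f = "alternating_labels t (Suc p)"] simplex_labels_singular_face) simp
    moreover have "even (int (card {k \<in> {..Suc p}. ?P k}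
      + of_bool (alternating_labels t (Suc (Suc p)) (?l ` {..Suc p}))
      + of_bool (alternating_labels (\<not> t) (Suc (Suc p)) (?l ` {..Suc p}))))"
      unfolding even_of_nat by (rule even_alternating_facets[OF assms[OF that]])
    ultimately show ?thesis
      using even_signed_card[where p = "Suc p" and P = ?P] unfolding of_nat_add of_nat_of_bool by presburger
  qed
  then show ?thesis
    unfolding alternating_count_def chain_boundary_def weight_extend
    by (simp only: nat.distinct if_False weight_extend) (rule even_weight)
qed

section \<open>Alternating counts under an antipodal symmetry\<close>

lemma alternating_map_Not: "alternating t (map (\<lambda>i. \<not> s i) xs) \<longleftrightarrow> alternating (\<not> t) (map s xs)"
  by (induction xs arbitrary: t) auto

text \<open>Injectivity of \<open>fst\<close> means that each index present carries exactly one
  sign, so swapping all signs negates the sign function on the sorted indices.\<close>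

lemma alternating_labels_flip:
  assumes "inj_on fst L" "finite L"
  shows "alternating_labels t q (map_prod id Not ` L) \<longleftrightarrow> alternating_labels (\<not> t) q L"
proof -
  have "(i, True) \<in> map_prod id Not ` L \<longleftrightarrow> (i, True) \<notin> L" if i: "i \<in> fst ` L" for i
  proof -
    have "(i, True) \<in> map_prod id Not ` L \<longleftrightarrow> (i, False) \<in> L"
      by force
    moreover have "(i, False) \<in> L \<longleftrightarrow> (i, True) \<notin> L"
    proof -
      obtain b where "(i, b) \<in> L" using i by auto
      moreover have "\<not> ((i, True) \<in> L \<and> (i, False) \<in> L)"
        using inj_onD[OF assms(1), of "(i, True)" "(i, False)"] by auto
      ultimately show ?thesis by (cases b) auto
    qed
    ultimately show ?thesis by simp
  qed
  then have h1: "map (\<lambda>i. (i, True) \<in> map_prod id Not ` L) (sorted_list_of_set (fst ` L))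
      = map (\<lambda>i. (i, True) \<notin> L) (sorted_list_of_set (fst ` L))"
    using assms(2) by (intro map_cong refl) simp
  have h2: "fst ` map_prod id Not ` L = fst ` L"
    by (force simp: image_iff)
  have h3: "card (map_prod id Not ` L) = card L"
    by (intro card_image) (auto simp: inj_on_def)
  show ?thesis
    unfolding alternating_labels_def h2 h1 h3 alternating_map_Not ..
qed

lemma alternating_count_chain_map:
  assumes c: "singular_chain p X c"
    and good: "\<And>\<sigma>. \<sigma> \<in> Poly_Mapping.keys c \<Longrightarrow> inj_on fst (simplex_labels lab p \<sigma>)"
    and \<nu>: "\<And>x. x \<in> topspace X \<Longrightarrow> lab (\<nu> x) = map_prod id Not (lab x)"
  shows "alternating_count lab t p (chain_map p \<nu> c) = alternating_count lab (\<not> t) p c"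
proof -
  have eq: "alternating_labels t (Suc p) (simplex_labels lab p (simplex_map p \<nu> \<sigma>))
      \<longleftrightarrow> alternating_labels (\<not> t) (Suc p) (simplex_labels lab p \<sigma>)"
    if \<sigma>: "\<sigma> \<in> Poly_Mapping.keys c" for \<sigma>
  proof -
    have "singular_simplex p X \<sigma>"
      using c \<sigma> by (auto simp: singular_chain_def)
    then have "simplicial_vertex k \<sigma> \<in> topspace X" if "k \<le> p" for k
      using that by (auto simp: singular_simplex_def simplicial_vertex_def continuous_map_def)
    then have "lab (simplicial_vertex k (simplex_map p \<nu> \<sigma>)) = map_prod id Not (lab (simplicial_vertex k \<sigma>))"
      if "k \<le> p" for k
      using that \<nu> by (simp add: simplicial_vertex_def simplex_map_def)
    then have "simplex_labels lab p (simplex_map p \<nu> \<sigma>) = map_prod id Not ` simplex_labels lab p \<sigma>"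
      unfolding image_image by (intro image_cong) auto
    then show ?thesis
      using alternating_labels_flip[OF good[OF \<sigma>]] by simp
  qed
  then show ?thesis
    unfolding alternating_count_def chain_map_def weight_extend comp_def weight_of
    unfolding weight_def by (intro sum.cong refl) (simp only: eq)
qed

text \<open>A 0-simplex has one label, hence exactly one starting sign. In the step, the boundary
  relation and the sign flip show that the count of the boundary from \<open>True\<close> is
  congruent to the sum of both counts of \<open>g i\<close>, while
  \<open>even_alternating_count_boundary\<close> makes it congruent to the sum of both counts of
  \<open>g (Suc i)\<close>.\<close>

lemma odd_alternating_count:
  fixes g :: "nat \<Rightarrow> 'a chain"
  assumes chain: "\<And>i. i \<le> n \<Longrightarrow> singular_chain i X (g i)"
    and g0: "g 0 = frag_of \<sigma>"
    and bd: "\<And>i. i < n \<Longrightarrow> chain_boundary (Suc i) (g (Suc i)) = chain_map i \<nu> (g i) + frag_cmul ((-1) ^ Suc i) (g i)"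
    and good: "\<And>i \<sigma>. i \<le> n \<Longrightarrow> \<sigma> \<in> Poly_Mapping.keys (g i) \<Longrightarrow> inj_on fst (simplex_labels lab i \<sigma>)"
    and \<nu>: "\<And>x. x \<in> topspace X \<Longrightarrow> lab (\<nu> x) = map_prod id Not (lab x)"
    and "i \<le> n"
  shows "odd (alternating_count lab True i (g i) + alternating_count lab False i (g i))"
  using \<open>i \<le> n\<close>
proof (induction i)
  case 0
  have "alternating_labels t (Suc 0) (simplex_labels lab 0 \<sigma>) \<longleftrightarrow> snd (lab (simplicial_vertex 0 \<sigma>)) = t" for t
    by (cases "lab (simplicial_vertex 0 \<sigma>)") (auto simp: alternating_labels_def)
  then show ?case
    by (simp add: g0 alternating_count_def)
next
  case (Suc i)
  have flip: "alternating_count lab True i (chain_map i \<nu> (g i)) = alternating_count lab (\<not> True) i (g i)"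
    using Suc.prems by (intro alternating_count_chain_map[OF chain good \<nu>]) auto
  have "alternating_count lab True i (chain_boundary (Suc i) (g (Suc i)))
      = alternating_count lab False i (g i) + (-1) ^ Suc i * alternating_count lab True i (g i)"
    using Suc.prems flip
    by (simp add: bd) (simp add: alternating_count_def weight_add weight_cmul)
  then have "odd (alternating_count lab True i (chain_boundary (Suc i) (g (Suc i))))"
    using Suc by simp
  moreover have "even (alternating_count lab True i (chain_boundary (Suc i) (g (Suc i)))
    + alternating_count lab True (Suc i) (g (Suc i)) + alternating_count lab (\<not> True) (Suc i) (g (Suc i)))"
    using Suc.prems good by (intro even_alternating_count_boundary) blast
  ultimately show ?case
    unfolding not_True_eq_False by presburger
qed

subsection \<open>Antipodal chains and the Borsuk-Ulam theorem\<close>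

lemma singular_relboundary_nsphere:
  assumes "0 < i" "i < n" "singular_relcycle i (nsphere n) {} c"
  shows "singular_relboundary i (nsphere n) {} c"
proof -
  have "trivial_group (homology_group (int i) (nsphere n))"
    using reduced_homology_group_nsphere(2)[of "int i" n] assms by (simp add: un_reduced_homology_group)
  then have "carrier (homology_group (int i) (nsphere n)) = {singular_relboundary_set i (nsphere n) {}}"
    unfolding trivial_group_def one_relative_homology_group by (rule conjunct2)
  moreover have "homologous_rel_set i (nsphere n) {} c \<in> carrier (homology_group (int i) (nsphere n))"
    unfolding carrier_relative_homology_group by (rule imageI) (use assms(3) in simp)
  ultimately have "homologous_rel_set i (nsphere n) {} c = singular_relboundary_set i (nsphere n) {}"
    by (simp only: singleton_iff)
  then show ?thesis
    unfolding homologous_rel_set_eq_relboundary .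
qed

text \<open>Degree 0 calls for reduced homology: the class of a difference of two points lies in the
  kernel of the map to a one-point space, and this kernel is trivial for a sphere of positive
  dimension.\<close>

lemma singular_relboundary_nsphere_0:
  assumes "0 < n" "singular_simplex 0 (nsphere n) \<sigma>" "singular_simplex 0 (nsphere n) \<tau>"
  shows "singular_relboundary 0 (nsphere n) {} (frag_of \<sigma> - frag_of \<tau>)"
proof -
  let ?X = "nsphere n" and ?Y = "discrete_topology {()}"
  let ?c = "frag_of \<sigma> - frag_of \<tau>"
  have c: "singular_relcycle 0 ?X {} ?c"
    unfolding singular_cycle using assms
    by (auto simp: singular_chain_of chain_boundary_def intro!: singular_chain_diff)
  have "chain_map 0 (\<lambda>x. ()) ?c = 0"
    by (simp add: chain_map_diff simplex_map_def comp_def)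
  then have "hom_induced (int 0) ?X {} ?Y {} (\<lambda>x. ()) (homologous_rel_set 0 ?X {} ?c) = \<one>\<^bsub>homology_group (int 0) ?Y\<^esub>"
    using hom_induced_chain_map[of ?X ?Y "\<lambda>x. ()" "{}" "{}" 0 ?c] c
    by (simp del: of_nat_0 add: homologous_rel_set_eq_relboundary)
  then have "homologous_rel_set 0 ?X {} ?c \<in> carrier (reduced_homology_group (int 0) ?X)"
    using imageI[of ?c "singular_relcycle_set 0 ?X {}" "homologous_rel_set 0 ?X {}"] c
    unfolding carrier_reduced_homology_group kernel_def carrier_relative_homology_group mem_Collect_eq by simp
  moreover have "trivial_group (reduced_homology_group (int 0) ?X)"
    using reduced_homology_group_nsphere(2)[of "int 0" n] assms by simp
  then have "carrier (reduced_homology_group (int 0) ?X) = {singular_relboundary_set 0 ?X {}}"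
    unfolding trivial_group_def one_reduced_homology_group one_relative_homology_group by (rule conjunct2)
  ultimately have "homologous_rel_set 0 ?X {} ?c = singular_relboundary_set 0 ?X {}"
    by (simp only: singleton_iff)
  then show ?thesis
    unfolding homologous_rel_set_eq_relboundary .
qed

abbreviation antipode :: "(nat \<Rightarrow> real) \<Rightarrow> nat \<Rightarrow> real" where
  "antipode x \<equiv> \<lambda>i. - x i"

lemma continuous_map_antipode: "continuous_map (nsphere n) (nsphere n) antipode"
proof -
  have "continuous_map (powertop_real UNIV) euclideanreal (\<lambda>x. - x k)" for k
    by (metis UNIV_I continuous_map_product_projection continuous_map_minus)
  then show ?thesis
    by (force simp: nsphere continuous_map_in_subtopology continuous_map_componentwise_UNIV
        intro: continuous_map_from_subtopology)
qed

lemma chain_map_antipode_antipode: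
  assumes "singular_chain p (nsphere n) c"
  shows "chain_map p antipode (chain_map p antipode c) = c"
proof -
  have "chain_map p antipode (chain_map p antipode c) = chain_map p (antipode \<circ> antipode) c"
    by (simp add: chain_map_compose)
  also have "\<dots> = c"
    using assms by (rule chain_map_id_gen) auto
  finally show ?thesis .
qed

text \<open>The next chain is a filling of the prescribed boundary \<open>?c\<close>. For
  \<open>m > 0\<close> the relation for \<open>h m\<close> shows that \<open>?c\<close> is a cycle:
  the terms cancel in pairs because the antipode is an involution. For \<open>m = 0\<close> it is a
  difference of two points. A filling exists since the degree is still below
  \<open>n\<close>.\<close>

lemma antipodal_chains_exist:
  assumes "m \<le> n"
  shows "\<exists>h \<sigma>. h 0 = frag_of \<sigma> \<and> (\<forall>i\<le>m. singular_chain i (nsphere n) (h i)) \<and>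
    (\<forall>i<m. chain_boundary (Suc i) (h (Suc i)) = chain_map i antipode (h i) + frag_cmul ((-1) ^ Suc i) (h i))"
  using assms
proof (induction m)
  case 0
  have "singular_simplex 0 (nsphere n) (restrict (\<lambda>_ n. if n = 0 then 1 else 0) (standard_simplex 0))"
    using in_topspace_nsphere by (auto simp: singular_simplex_def)
  then obtain \<sigma> where "singular_simplex 0 (nsphere n) \<sigma>" ..
  then show ?case
    by (intro exI[of _ "\<lambda>i. frag_of \<sigma>"] exI[of _ \<sigma>]) (simp add: singular_chain_of)
next
  case (Suc m)
  then obtain h \<sigma> where h: "h 0 = frag_of \<sigma>" "\<And>i. i \<le> m \<Longrightarrow> singular_chain i (nsphere n) (h i)"
    and bd: "\<And>i. i < m \<Longrightarrow> chain_boundary (Suc i) (h (Suc i)) = chain_map i antipode (h i) + frag_cmul ((-1) ^ Suc i) (h i)"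
    by auto
  let ?c = "chain_map m antipode (h m) + frag_cmul ((-1) ^ Suc m) (h m)"
  have "singular_relboundary m (nsphere n) {} ?c"
  proof (cases m)
    case 0
    have "singular_simplex 0 (nsphere n) \<sigma>"
      using h(2)[of 0] by (simp add: h(1) singular_chain_of)
    then have "singular_relboundary 0 (nsphere n) {} (frag_of (simplex_map 0 antipode \<sigma>) - frag_of \<sigma>)"
      using Suc.prems by (intro singular_relboundary_nsphere_0 singular_simplex_simplex_map[OF _ continuous_map_antipode]) auto
    then show ?thesis
      by (simp add: 0 h(1))
  next
    case (Suc j)
    have hm: "singular_chain m (nsphere n) (h m)" and hj: "singular_chain j (nsphere n) (h j)"
      using h(2) Suc by auto
    have bm: "chain_boundary m (h m) = chain_map j antipode (h j) + frag_cmul ((-1) ^ m) (h j)"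
      using bd[of j] Suc by simp
    have "chain_boundary m ?c = chain_map j antipode (chain_boundary m (h m)) + frag_cmul ((-1) ^ Suc m) (chain_boundary m (h m))"
      using chain_boundary_chain_map[OF hm, of antipode] Suc by (simp add: chain_boundary_add chain_boundary_cmul chain_boundary_minus)
    also have "\<dots> = 0"
      unfolding bm by (cases "even m")
        (simp_all add: chain_map_add chain_map_diff chain_map_minus chain_map_antipode_antipode[OF hj])
    finally have "singular_relcycle m (nsphere n) {} ?c"
      unfolding singular_cycle
      by (intro conjI singular_chain_add singular_chain_cmul hm singular_chain_chain_map[OF hm continuous_map_antipode])
    then show ?thesis
      using Suc Suc.prems \<open>Suc m \<le> n\<close> by (intro singular_relboundary_nsphere) auto
  qed
  then obtain d where d: "singular_chain (Suc m) (nsphere n) d" "chain_boundary (Suc m) d = ?c"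
    unfolding singular_boundary by blast
  show ?case
    by (intro exI[of _ "h(Suc m := d)"] exI[of _ \<sigma>])
      (use h bd d in \<open>auto simp: less_Suc_eq le_Suc_eq\<close>)
qed

section \<open>Antipodal chains of small simplices\<close>

lemma singular_chain_iterated_subdivision:
  "singular_chain p X c \<Longrightarrow> singular_chain p X ((singular_subdivision p ^^ m) c)"
  by (induction m) (auto intro: singular_chain_singular_subdivision)

lemma chain_boundary_iterated_subdivision:
  "singular_chain (Suc p) X c \<Longrightarrow>
    chain_boundary (Suc p) ((singular_subdivision (Suc p) ^^ m) c) = (singular_subdivision p ^^ m) (chain_boundary (Suc p) c)"
  by (induction m) (simp_all add: chain_boundary_singular_subdivision[OF singular_chain_iterated_subdivision])

lemma chain_map_iterated_subdivision:
  "singular_chain p X c \<Longrightarrow>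
    (singular_subdivision p ^^ m) (chain_map p g c) = chain_map p g ((singular_subdivision p ^^ m) c)"
  by (induction m) (simp_all add: naturality_singular_subdivision[OF singular_chain_iterated_subdivision])

lemma iterated_subdivision_add_signed:
  "(singular_subdivision p ^^ m) (a + frag_cmul ((-1) ^ k) b)
    = (singular_subdivision p ^^ m) a + frag_cmul ((-1) ^ k) ((singular_subdivision p ^^ m) b)"
proof -
  have neg: "(singular_subdivision p ^^ m) (- c) = - (singular_subdivision p ^^ m) c" for c :: "'a chain"
    using singular_subdivision_power_diff[of m p 0 c] by simp
  have "(singular_subdivision p ^^ m) (a + b) = (singular_subdivision p ^^ m) a + (singular_subdivision p ^^ m) b" for b
    using singular_subdivision_power_diff[of m p a "- b"] neg[of b] by simp
  then show ?thesis
    using singular_subdivision_power_diff[of m p a b] by (cases "even k") simp_all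
qed

text \<open>All degrees are subdivided the same number of times, and subdivision commutes with
  boundaries and induced maps, so the boundary relations survive. In degree 0 it is the identity, so
  \<open>g 0\<close> remains a single simplex.\<close>

lemma fine_antipodal_chains_exist:
  assumes \<C>: "\<And>U. U \<in> \<C> \<Longrightarrow> openin (nsphere n) U" "topspace (nsphere n) \<subseteq> \<Union>\<C>"
  obtains g \<sigma> where "g 0 = frag_of \<sigma>" "\<And>i. i \<le> n \<Longrightarrow> singular_chain i (nsphere n) (g i)"
    "\<And>i. i < n \<Longrightarrow> chain_boundary (Suc i) (g (Suc i)) = chain_map i antipode (g i) + frag_cmul ((-1) ^ Suc i) (g i)"
    "\<And>i f. i \<le> n \<Longrightarrow> f \<in> Poly_Mapping.keys (g i) \<Longrightarrow> \<exists>V\<in>\<C>. f \<in> standard_simplex i \<rightarrow> V"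
proof -
  obtain h \<sigma> where h0: "h 0 = frag_of \<sigma>" and h: "\<And>i. i \<le> n \<Longrightarrow> singular_chain i (nsphere n) (h i)"
    and bd: "\<And>i. i < n \<Longrightarrow> chain_boundary (Suc i) (h (Suc i)) = chain_map i antipode (h i) + frag_cmul ((-1) ^ Suc i) (h i)"
    using antipodal_chains_exist[of n n] by auto
  have "\<exists>M. \<forall>m\<ge>M. \<forall>f\<in>Poly_Mapping.keys ((singular_subdivision i ^^ m) (h i)). \<exists>V\<in>\<C>. f \<in> standard_simplex i \<rightarrow> V"
    if "i \<le> n" for i
    using sufficient_iterated_singular_subdivision_exists[OF \<C> h[OF that]] by metis
  then obtain M where M: "\<And>i m f. i \<le> n \<Longrightarrow> M i \<le> m \<Longrightarrow> f \<in> Poly_Mapping.keys ((singular_subdivision i ^^ m) (h i))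
      \<Longrightarrow> \<exists>V\<in>\<C>. f \<in> standard_simplex i \<rightarrow> V"
    by metis
  define m where "m = Max (M ` {..n})"
  have m: "M i \<le> m" if "i \<le> n" for i
    using that by (simp add: m_def)
  define g where "g i = (singular_subdivision i ^^ m) (h i)" for i
  have "g 0 = frag_of \<sigma>"
  proof -
    have "singular_chain 0 (nsphere n) (h 0)" by (simp add: h)
    then have "(singular_subdivision 0 ^^ k) (h 0) = h 0" for k
      by (induction k) (auto simp: singular_subdivision_zero)
    then show ?thesis by (simp add: g_def h0)
  qed
  moreover have "singular_chain i (nsphere n) (g i)" if "i \<le> n" for i
    unfolding g_def by (intro singular_chain_iterated_subdivision h that)
  moreover have "chain_boundary (Suc i) (g (Suc i)) = chain_map i antipode (g i) + frag_cmul ((-1) ^ Suc i) (g i)"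
    if "i < n" for i
  proof -
    have "chain_boundary (Suc i) (g (Suc i)) = (singular_subdivision i ^^ m) (chain_boundary (Suc i) (h (Suc i)))"
      unfolding g_def using h[of "Suc i"] that by (intro chain_boundary_iterated_subdivision) auto
    also have "\<dots> = chain_map i antipode (g i) + frag_cmul ((-1) ^ Suc i) (g i)"
      unfolding bd[OF that] iterated_subdivision_add_signed g_def
      using chain_map_iterated_subdivision[OF h[of i]] that by simp
    finally show ?thesis .
  qed
  moreover have "\<exists>V\<in>\<C>. f \<in> standard_simplex i \<rightarrow> V" if "i \<le> n" "f \<in> Poly_Mapping.keys (g i)" for i f
    using M[OF that(1) m[OF that(1)]] that(2) unfolding g_def by blast
  ultimately show ?thesis
    using that by blast
qed

theorem Borsuk_Ulam:
  assumes f: "continuous_map (nsphere n) (Euclidean_space n) f"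
    and odd: "\<And>x. x \<in> topspace (nsphere n) \<Longrightarrow> f (antipode x) = antipode (f x)"
  shows "\<exists>x\<in>topspace (nsphere n). f x = (\<lambda>i. 0)"
proof (rule ccontr)
  assume "\<not> ?thesis"
  then have nz: "f x \<noteq> (\<lambda>i. 0)" if "x \<in> topspace (nsphere n)" for x
    using that by blast
  have ft: "f x \<in> topspace (Euclidean_space n)" if "x \<in> topspace (nsphere n)" for x
    using f that by (auto simp: continuous_map_def)
  define top where "top y i \<longleftrightarrow> i < n \<and> (\<forall>j<n. \<bar>y j\<bar> \<le> \<bar>y i\<bar>)" for y :: "nat \<Rightarrow> real" and i
  \<comment> \<open>\<open>idx x\<close> depends on \<open>x\<close> only through the set of maximal
    coordinates of \<open>f x\<close>, which antipodal points share. Hence they receive the same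
    index, with opposite signs.\<close>
  define idx where "idx x = (SOME i. top (f x) i)" for x
  define lab where "lab x = (idx x, f x (idx x) > 0)" for x
  have idx: "top (f x) (idx x)" "f x (idx x) \<noteq> 0" if x: "x \<in> topspace (nsphere n)" for x
  proof -
    obtain j where j: "f x j \<noteq> 0"
      using nz[OF x] by auto
    have "\<forall>i\<ge>n. f x i = 0"
      using ft[OF x] by (simp add: topspace_Euclidean_space)
    with j have "j < n"
      by (auto simp: not_less[symmetric])
    let ?M = "(\<lambda>i. \<bar>f x i\<bar>) ` {..<n}"
    have "Max ?M \<in> ?M"
      using \<open>j < n\<close> by (intro Max_in) auto
    then obtain i where "i < n" "\<bar>f x i\<bar> = Max ?M"
      by auto
    then have "\<forall>k<n. \<bar>f x k\<bar> \<le> \<bar>f x i\<bar>"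
      by simp
    with \<open>i < n\<close> have "\<exists>i. top (f x) i" by (auto simp: top_def)
    then show t: "top (f x) (idx x)"
      unfolding idx_def by (rule someI_ex)
    then show "f x (idx x) \<noteq> 0"
      using j \<open>j < n\<close> unfolding top_def by fastforce
  qed
  have lab_antipode: "lab (antipode x) = map_prod id Not (lab x)" if x: "x \<in> topspace (nsphere n)" for x
  proof -
    have "top (f (antipode x)) = top (f x)"
      by (simp add: top_def odd[OF x] fun_eq_iff)
    then have "idx (antipode x) = idx x"
      by (simp add: idx_def)
    then show ?thesis
      using idx(2)[OF x] by (auto simp: lab_def odd[OF x])
  qed
  \<comment> \<open>Let M be the largest absolute coordinate of \<open>f x\<close>. For
    \<open>y\<close> in \<open>V x\<close> the coordinate \<open>f y (idx y)\<close> exceeds M/2 in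
    absolute value and differs from \<open>f x (idx y)\<close> by less than M/2, so both have the
    same sign. Thus no index occurs with both signs on \<open>V x\<close>.\<close>
  define V where "V x = {y \<in> topspace (nsphere n). \<forall>i<n. \<bar>f y i - f x i\<bar> < \<bar>f x (idx x)\<bar> / 2}" for x
  have fi: "continuous_map (nsphere n) euclideanreal (\<lambda>x. f x i)" for i
    using f by (simp add: Euclidean_space_def continuous_map_in_subtopology continuous_map_componentwise_UNIV)
  have V_open: "openin (nsphere n) (V x)" for x
  proof -
    have "openin (nsphere n) {y \<in> topspace (nsphere n). \<bar>f y i - f x i\<bar> < \<bar>f x (idx x)\<bar> / 2}" for i
    proof -
      have "continuous_map (nsphere n) euclideanreal (\<lambda>y. \<bar>f y i - f x i\<bar>)"
        by (intro continuous_intros fi)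
      from openin_continuous_map_preimage[OF this, of "{..<\<bar>f x (idx x)\<bar> / 2}"] show ?thesis
        by simp
    qed
    then have "openin (nsphere n) ((\<Inter>i\<in>{..<n}. {y \<in> topspace (nsphere n). \<bar>f y i - f x i\<bar> < \<bar>f x (idx x)\<bar> / 2}) \<inter> topspace (nsphere n))"
      by (intro openin_INT finite_lessThan)
    also have "(\<Inter>i\<in>{..<n}. {y \<in> topspace (nsphere n). \<bar>f y i - f x i\<bar> < \<bar>f x (idx x)\<bar> / 2}) \<inter> topspace (nsphere n) = V x"
      unfolding V_def by blast
    finally show ?thesis .
  qed
  have V_good: "f y (idx y) > 0 \<longleftrightarrow> f x (idx y) > 0" if x: "x \<in> topspace (nsphere n)" and y: "y \<in> V x" for x y
  proof -
    have yt: "y \<in> topspace (nsphere n)" and close: "\<And>i. i < n \<Longrightarrow> \<bar>f y i - f x i\<bar> < \<bar>f x (idx x)\<bar> / 2"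
      using y by (auto simp: V_def)
    have "idx x < n" "idx y < n" "\<bar>f y (idx x)\<bar> \<le> \<bar>f y (idx y)\<bar>"
      using idx[OF x] idx[OF yt] by (auto simp: top_def)
    then show ?thesis
      using close[of "idx x"] close[of "idx y"] by argo
  qed
  have cover: "topspace (nsphere n) \<subseteq> \<Union> (V ` topspace (nsphere n))"
    using idx(2) by (force simp: V_def)
  have opens: "openin (nsphere n) U" if "U \<in> V ` topspace (nsphere n)" for U
    using that V_open by blast
  obtain g \<sigma> where g: "g 0 = frag_of \<sigma>" "\<And>i. i \<le> n \<Longrightarrow> singular_chain i (nsphere n) (g i)"
    "\<And>i. i < n \<Longrightarrow> chain_boundary (Suc i) (g (Suc i)) = chain_map i antipode (g i) + frag_cmul ((-1) ^ Suc i) (g i)"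
    and fine: "\<And>i f. i \<le> n \<Longrightarrow> f \<in> Poly_Mapping.keys (g i) \<Longrightarrow> \<exists>U\<in>V ` topspace (nsphere n). f \<in> standard_simplex i \<rightarrow> U"
    by (rule fine_antipodal_chains_exist[OF opens cover]; (rule that; assumption)?)
  have good: "inj_on fst (simplex_labels lab i \<tau>)" if \<tau>: "i \<le> n" "\<tau> \<in> Poly_Mapping.keys (g i)" for i \<tau>
  proof -
    obtain x where x: "x \<in> topspace (nsphere n)" "\<tau> \<in> standard_simplex i \<rightarrow> V x"
      using fine[OF \<tau>] by blast
    have "simplicial_vertex k \<tau> \<in> V x" if "k \<le> i" for k
      using x(2) that by (auto simp: simplicial_vertex_def)
    then have "snd (lab (simplicial_vertex k \<tau>)) \<longleftrightarrow> f x (fst (lab (simplicial_vertex k \<tau>))) > 0" if "k \<le> i" for k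
      using V_good[OF x(1)] that by (simp add: lab_def)
    then show ?thesis
      by (intro inj_onI) (auto simp: prod_eq_iff)
  qed
  have "odd (alternating_count lab True n (g n) + alternating_count lab False n (g n))"
    by (rule odd_alternating_count[where \<nu> = antipode and g = g and lab = lab and X = "nsphere n" and n = n,
        OF g(2,1,3) good lab_antipode]) auto
  then have "alternating_count lab True n (g n) \<noteq> 0 \<or> alternating_count lab False n (g n) \<noteq> 0"
    by auto
  then obtain t where "alternating_count lab t n (g n) \<noteq> 0"
    by blast
  then obtain \<tau> where \<tau>: "\<tau> \<in> Poly_Mapping.keys (g n)" "alternating_labels t (Suc n) (simplex_labels lab n \<tau>)"
    unfolding alternating_count_def weight_def
    by (elim sum.not_neutral_contains_not_neutral) (auto split: if_splits)
  have "simplicial_vertex k \<tau> \<in> topspace (nsphere n)" if "k \<le> n" for k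
  proof -
    obtain x where "\<tau> \<in> standard_simplex n \<rightarrow> V x"
      using fine[OF order_refl \<tau>(1)] by blast
    then show ?thesis
      using that by (auto simp: simplicial_vertex_def V_def Pi_iff)
  qed
  \<comment> \<open>Pigeonhole: an alternating simplex has \<open>Suc n\<close> distinct labels with
    distinct indices, but there are only \<open>n\<close> indices.\<close>
  then have "fst ` simplex_labels lab n \<tau> \<subseteq> {..<n}"
    using idx(1) by (auto simp: lab_def top_def)
  then have "card (simplex_labels lab n \<tau>) \<le> n"
    using card_inj_on_le[OF good[OF order_refl \<tau>(1)], of "{..<n}"] by simp
  then show False
    using \<tau>(2) by (simp add: alternating_labels_def)
qed

subsection \<open>Subdifferentials of the total variation and of the degree norm\<close>

definition degree_norm :: "('n::finite) rel \<Rightarrow> real ^ 'n \<Rightarrow> real" where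
  "degree_norm E x = (\<Sum>i\<in>UNIV. real (vertex_degree E i) * \<bar>x $ i\<bar>)"

definition edge_flows :: "('n::finite) rel \<Rightarrow> real ^ 'n \<Rightarrow> ('n \<Rightarrow> 'n \<Rightarrow> real) set" where
  "edge_flows E x = {z. \<forall>i j. (i, j) \<in> E \<longrightarrow> z i j \<in> Sgn (x $ i - x $ j) \<and> z j i = - z i j}"

definition divergence :: "('n::finite) rel \<Rightarrow> ('n \<Rightarrow> 'n \<Rightarrow> real) \<Rightarrow> real ^ 'n" where
  "divergence E z = (\<chi> i. \<Sum>j | (i, j) \<in> E. z i j)"

text \<open>For symmetric \<open>E\<close> this is the convex subdifferential of \<open>tv E\<close>
  at \<open>x\<close>.\<close>

definition tv_subdiff :: "('n::finite) rel \<Rightarrow> real ^ 'n \<Rightarrow> (real ^ 'n) set" where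
  "tv_subdiff E x = divergence E ` edge_flows E x"

text \<open>For \<open>0 \<le> \<mu>\<close> this is the subdifferential of \<open>\<mu>\<close>
  times the degree norm, a product of points and intervals because the norm is separable.\<close>

definition norm_subdiff :: "('n::finite) rel \<Rightarrow> real \<Rightarrow> real ^ 'n \<Rightarrow> (real ^ 'n) set" where
  "norm_subdiff E \<mu> x = {q. \<forall>i. q $ i \<in> (\<lambda>s. \<mu> * real (vertex_degree E i) * s) ` Sgn (x $ i)}"

text \<open>Strict separation is required of all pairs. In this form the condition passes to sums
  and positive multiples of directions and to points with smaller subdifferentials.\<close>

definition descent_direction :: "('n::finite) rel \<Rightarrow> real \<Rightarrow> real ^ 'n \<Rightarrow> real ^ 'n \<Rightarrow> bool" where
  "descent_direction E \<mu> x v \<longleftrightarrow> (\<forall>p\<in>tv_subdiff E x. \<forall>q\<in>norm_subdiff E \<mu> x. p \<bullet> v < q \<bullet> v)"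

lemma one_laplacian_eigenvector_iff:
  "one_laplacian_eigenvector E \<mu> x \<longleftrightarrow> x \<noteq> 0 \<and> tv_subdiff E x \<inter> norm_subdiff E \<mu> x \<noteq> {}"
proof -
  have "tv_subdiff E x \<inter> norm_subdiff E \<mu> x \<noteq> {} \<longleftrightarrow> (\<exists>z\<in>edge_flows E x. divergence E z \<in> norm_subdiff E \<mu> x)"
    unfolding tv_subdiff_def by blast
  then show ?thesis
    unfolding one_laplacian_eigenvector_def edge_flows_def norm_subdiff_def divergence_def Bex_def mem_Collect_eq
    by (simp only: vec_lambda_beta)
qed

section \<open>Subgradient inequalities\<close>

lemma Sgn_cases: "s \<in> Sgn t \<Longrightarrow> \<bar>s\<bar> \<le> 1 \<and> s * t = \<bar>t\<bar>"
  by (auto simp: Sgn_def split: if_splits)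

lemma Sgn_uminus: "s \<in> Sgn t \<Longrightarrow> - s \<in> Sgn (- t)"
  by (auto simp: Sgn_def split: if_splits)

lemma sgn_in_Sgn: "sgn t \<in> Sgn t"
  by (auto simp: Sgn_def sgn_if)

lemma mult_le_abs: "\<bar>s\<bar> \<le> 1 \<Longrightarrow> s * t \<le> \<bar>t :: real\<bar>"
  using mult_left_le_one_le[of "\<bar>t\<bar>" "\<bar>s\<bar>"] abs_ge_self[of "s * t"] by (simp add: abs_mult)

lemma closed_Sgn: "closed (Sgn t)"
  by (simp add: Sgn_def)

lemma convex_Sgn: "convex (Sgn t)"
  by (simp add: Sgn_def)

text \<open>A nonzero limit fixes the sign nearby, and at limit 0 the right-hand side is all of
  [-1,1]. This is the source of the upper semicontinuity of both subdifferentials.\<close>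

lemma Sgn_subset_nhd:
  assumes "(f \<longlongrightarrow> a) F"
  shows "\<forall>\<^sub>F y in F. Sgn (f y) \<subseteq> Sgn a"
proof (cases a "0 :: real" rule: linorder_cases)
  case less
  with assms have "\<forall>\<^sub>F y in F. f y < 0" by (rule order_tendstoD)
  then show ?thesis by eventually_elim (use less in \<open>auto simp: Sgn_def\<close>)
next
  case equal
  then show ?thesis by (auto simp: Sgn_def)
next
  case greater
  with assms have "\<forall>\<^sub>F y in F. f y > 0" by (rule order_tendstoD)
  then show ?thesis by eventually_elim (use greater in \<open>auto simp: Sgn_def\<close>)
qed

lemma sum_edges: "(\<Sum>i\<in>UNIV. \<Sum>j | (i, j) \<in> E. g i j) = (\<Sum>(i, j)\<in>E. g i j)"
  for E :: "('n::finite) rel"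
proof -
  have "E = Sigma UNIV (\<lambda>i. {j. (i, j) \<in> E})" by auto
  then show ?thesis by (subst (2) \<open>E = _\<close>) (simp add: sum.Sigma)
qed

text \<open>Summation by parts: reversing every edge and using the antisymmetry of \<open>z\<close>
  gives a second expression for the same sum, and the two are averaged.\<close>

lemma divergence_inner:
  assumes "sym E" "z \<in> edge_flows E x"
  shows "divergence E z \<bullet> y = (\<Sum>(i, j)\<in>E. z i j * (y $ i - y $ j)) / 2"
proof -
  have "divergence E z \<bullet> y = (\<Sum>(i, j)\<in>E. z i j * y $ i)"
    by (simp add: inner_vec_def divergence_def sum_distrib_right sum_edges)
  moreover have "(\<Sum>(i, j)\<in>E. z i j * y $ i) = (\<Sum>(i, j)\<in>E. z j i * y $ j)"
    using \<open>sym E\<close> by (intro sum.reindex_bij_witness[of _ prod.swap prod.swap]) (auto dest: symD)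
  moreover have "(\<Sum>(i, j)\<in>E. z j i * y $ j) = (\<Sum>(i, j)\<in>E. - (z i j * y $ j))"
    using assms(2) by (intro sum.cong) (auto simp: edge_flows_def)
  ultimately have "2 * (divergence E z \<bullet> y) = (\<Sum>(i, j)\<in>E. z i j * y $ i) + (\<Sum>(i, j)\<in>E. - (z i j * y $ j))"
    by linarith
  also have "\<dots> = (\<Sum>(i, j)\<in>E. z i j * (y $ i - y $ j))"
    by (simp add: sum.distrib[symmetric] case_prod_unfold right_diff_distrib)
  finally show ?thesis by simp
qed

lemma tv_subdiff_inner_le:
  assumes "sym E" "p \<in> tv_subdiff E x"
  shows "p \<bullet> y \<le> tv E y"
proof -
  obtain z where z: "z \<in> edge_flows E x" "p = divergence E z"
    using assms(2) by (auto simp: tv_subdiff_def)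
  have "(\<Sum>(i, j)\<in>E. z i j * (y $ i - y $ j)) \<le> (\<Sum>(i, j)\<in>E. \<bar>y $ i - y $ j\<bar>)"
    using z(1) by (intro sum_mono) (auto simp: edge_flows_def intro!: mult_le_abs dest: Sgn_cases)
  then show ?thesis
    unfolding z(2) divergence_inner[OF assms(1) z(1)] tv_def by simp
qed

text \<open>Euler's identity for a 1-homogeneous convex function; together with
  \<open>tv_subdiff_inner_le\<close> it gives the subgradient inequality at
  \<open>x\<close>.\<close>

lemma tv_subdiff_inner_self:
  assumes "sym E" "p \<in> tv_subdiff E x"
  shows "p \<bullet> x = tv E x"
proof -
  obtain z where z: "z \<in> edge_flows E x" "p = divergence E z"
    using assms(2) by (auto simp: tv_subdiff_def)
  have "(\<Sum>(i, j)\<in>E. z i j * (x $ i - x $ j)) = (\<Sum>(i, j)\<in>E. \<bar>x $ i - x $ j\<bar>)"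
    using z(1) by (intro sum.cong) (auto simp: edge_flows_def dest: Sgn_cases)
  then show ?thesis
    unfolding z(2) divergence_inner[OF assms(1) z(1)] tv_def by simp
qed

lemma norm_subdiff_inner_le:
  assumes "0 \<le> \<mu>" "q \<in> norm_subdiff E \<mu> x"
  shows "q \<bullet> y \<le> \<mu> * degree_norm E y"
proof -
  have "q $ i * y $ i \<le> \<mu> * (real (vertex_degree E i) * \<bar>y $ i\<bar>)" for i
  proof -
    obtain s where s: "s \<in> Sgn (x $ i)" "q $ i = \<mu> * real (vertex_degree E i) * s"
      using assms(2) unfolding norm_subdiff_def by blast
    have "s * y $ i \<le> \<bar>y $ i\<bar>"
      using Sgn_cases[OF s(1)] mult_le_abs by blast
    then have "(\<mu> * real (vertex_degree E i)) * (s * y $ i) \<le> (\<mu> * real (vertex_degree E i)) * \<bar>y $ i\<bar>"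
      using assms(1) by (intro mult_left_mono) auto
    then show ?thesis by (simp add: s(2) mult.assoc)
  qed
  then show ?thesis
    unfolding inner_vec_def degree_norm_def sum_distrib_left by (intro sum_mono) simp
qed

lemma norm_subdiff_inner_self:
  assumes "q \<in> norm_subdiff E \<mu> x"
  shows "q \<bullet> x = \<mu> * degree_norm E x"
proof -
  have "q $ i * x $ i = \<mu> * (real (vertex_degree E i) * \<bar>x $ i\<bar>)" for i
  proof -
    obtain s where s: "s \<in> Sgn (x $ i)" "q $ i = \<mu> * real (vertex_degree E i) * s"
      using assms unfolding norm_subdiff_def by blast
    then show ?thesis using Sgn_cases[OF s(1)] by (simp add: mult.assoc)
  qed
  then show ?thesis
    unfolding inner_vec_def degree_norm_def sum_distrib_left by (intro sum.cong) auto
qed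

section \<open>Nonemptiness, symmetry, convexity and compactness of the subdifferentials\<close>

lemma tv_subdiff_nonempty: "\<exists>p. p \<in> tv_subdiff E x"
proof -
  have "sgn (x $ j - x $ i) = - sgn (x $ i - x $ j)" for i j
    by (simp add: sgn_if)
  then have "(\<lambda>i j. sgn (x $ i - x $ j)) \<in> edge_flows E x"
    unfolding edge_flows_def using sgn_in_Sgn by blast
  then show ?thesis by (auto simp: tv_subdiff_def)
qed

lemma norm_subdiff_nonempty: "\<exists>q. q \<in> norm_subdiff E \<mu> x"
  by (intro exI[of _ "\<chi> i. \<mu> * real (vertex_degree E i) * sgn (x $ i)"])
    (auto simp: norm_subdiff_def sgn_in_Sgn)

lemma tv_subdiff_uminus: "p \<in> tv_subdiff E x \<Longrightarrow> - p \<in> tv_subdiff E (- x)"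
proof -
  assume "p \<in> tv_subdiff E x"
  then obtain z where z: "z \<in> edge_flows E x" "p = divergence E z"
    by (auto simp: tv_subdiff_def)
  have "- z i j \<in> Sgn ((- x) $ i - (- x) $ j)" if "(i, j) \<in> E" for i j
    using Sgn_uminus[of "z i j" "x $ i - x $ j"] z(1) that by (auto simp: edge_flows_def)
  then have "(\<lambda>i j. - z i j) \<in> edge_flows E (- x)"
    using z(1) by (auto simp: edge_flows_def)
  moreover have "- p = divergence E (\<lambda>i j. - z i j)"
    by (simp add: z(2) divergence_def vec_eq_iff sum_negf)
  ultimately show ?thesis by (auto simp: tv_subdiff_def)
qed

lemma norm_subdiff_uminus: "q \<in> norm_subdiff E \<mu> x \<Longrightarrow> - q \<in> norm_subdiff E \<mu> (- x)"
  unfolding norm_subdiff_def mem_Collect_eq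
proof
  fix i assume "\<forall>i. q $ i \<in> (\<lambda>s. \<mu> * real (vertex_degree E i) * s) ` Sgn (x $ i)"
  then obtain s where "s \<in> Sgn (x $ i)" "q $ i = \<mu> * real (vertex_degree E i) * s" by blast
  then show "(- q) $ i \<in> (\<lambda>s. \<mu> * real (vertex_degree E i) * s) ` Sgn ((- x) $ i)"
    using Sgn_uminus by (intro image_eqI[of _ _ "- s"]) auto
qed

lemma convex_tv_subdiff: "convex (tv_subdiff E x)"
proof (rule convexI)
  fix p q u v assume "p \<in> tv_subdiff E x" "q \<in> tv_subdiff E x" and uv: "0 \<le> u" "0 \<le> v" "u + v = (1::real)"
  then obtain z w where z: "z \<in> edge_flows E x" "p = divergence E z" and w: "w \<in> edge_flows E x" "q = divergence E w"
    by (auto simp: tv_subdiff_def)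
  have "(\<lambda>i j. u * z i j + v * w i j) \<in> edge_flows E x"
    using z(1) w(1) convexD[OF convex_Sgn _ _ uv] by (fastforce simp: edge_flows_def)
  moreover have "u *\<^sub>R p + v *\<^sub>R q = divergence E (\<lambda>i j. u * z i j + v * w i j)"
    by (simp add: z(2) w(2) divergence_def vec_eq_iff sum.distrib sum_distrib_left)
  ultimately show "u *\<^sub>R p + v *\<^sub>R q \<in> tv_subdiff E x"
    by (auto simp: tv_subdiff_def)
qed

lemma convex_norm_subdiff: "convex (norm_subdiff E \<mu> x)"
proof (rule convexI)
  fix p q u v assume p: "p \<in> norm_subdiff E \<mu> x" and q: "q \<in> norm_subdiff E \<mu> x"
    and uv: "0 \<le> u" "0 \<le> v" "u + v = (1::real)"
  show "u *\<^sub>R p + v *\<^sub>R q \<in> norm_subdiff E \<mu> x"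
    unfolding norm_subdiff_def mem_Collect_eq
  proof
    fix i
    let ?c = "\<mu> * real (vertex_degree E i)"
    obtain s where s: "s \<in> Sgn (x $ i)" "p $ i = ?c * s"
      using p unfolding norm_subdiff_def by blast
    obtain t where t: "t \<in> Sgn (x $ i)" "q $ i = ?c * t"
      using q unfolding norm_subdiff_def by blast
    have "u *\<^sub>R s + v *\<^sub>R t \<in> Sgn (x $ i)"
      using convexD[OF convex_Sgn s(1) t(1) uv] .
    moreover have "(u *\<^sub>R p + v *\<^sub>R q) $ i = ?c * (u *\<^sub>R s + v *\<^sub>R t)"
      by (simp add: s(2) t(2) algebra_simps)
    ultimately show "(u *\<^sub>R p + v *\<^sub>R q) $ i \<in> (\<lambda>s. ?c * s) ` Sgn (x $ i)"
      by (rule rev_image_eqI)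
  qed
qed

lemma closed_norm_subdiff: "closed (norm_subdiff E \<mu> x)"
proof -
  have "closed ((\<lambda>s. \<mu> * real (vertex_degree E i) * s) ` Sgn (x $ i))" for i
    using closed_scaling[OF closed_Sgn, of "\<mu> * real (vertex_degree E i)" "x $ i"] by simp
  then have "closed {q. q $ i \<in> (\<lambda>s. \<mu> * real (vertex_degree E i) * s) ` Sgn (x $ i)}" for i
    by (intro closed_vimage[of _ "\<lambda>q. q $ i", unfolded vimage_def] continuous_intros)
  then show ?thesis
    unfolding norm_subdiff_def by (intro closed_Collect_all)
qed

lemma compact_tv_subdiff: "compact (tv_subdiff E x)"
proof -
  \<comment> \<open>\<open>edge_flows\<close> leaves values off the edges free and so is not
    bounded. \<open>Z\<close> sets them to 0 without changing the divergences; a pair whose reverse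
    is an edge is already fixed by antisymmetry.\<close>
  define Z where "Z = {z :: real ^ 'a ^ 'a. \<forall>i j.
    (if (i, j) \<in> E then z $ i $ j \<in> Sgn (x $ i - x $ j) \<and> z $ j $ i + z $ i $ j = 0
     else (j, i) \<in> E \<or> z $ i $ j = 0)}"
  have Z: "if (i, j) \<in> E then z $ i $ j \<in> Sgn (x $ i - x $ j) \<and> z $ j $ i + z $ i $ j = 0
     else (j, i) \<in> E \<or> z $ i $ j = 0" if "z \<in> Z" for z i j
    using that unfolding Z_def mem_Collect_eq by (elim allE)
  have "closed {z :: real ^ 'a ^ 'a. if (i, j) \<in> E then z $ i $ j \<in> Sgn (x $ i - x $ j) \<and> z $ j $ i + z $ i $ j = 0
     else (j, i) \<in> E \<or> z $ i $ j = 0}" for i j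
  proof -
    have "closed {z :: real ^ 'a ^ 'a. z $ i $ j \<in> Sgn (x $ i - x $ j)}"
      by (intro closed_vimage[of _ "\<lambda>z. z $ i $ j", unfolded vimage_def] closed_Sgn continuous_intros)
    then have "closed {z :: real ^ 'a ^ 'a. z $ i $ j \<in> Sgn (x $ i - x $ j) \<and> z $ j $ i + z $ i $ j = 0}"
      by (intro closed_Collect_conj closed_Collect_eq continuous_intros)
    moreover have "closed {z :: real ^ 'a ^ 'a. z $ i $ j = 0}"
      by (intro closed_Collect_eq continuous_intros)
    ultimately show ?thesis
      by (cases "(i, j) \<in> E"; cases "(j, i) \<in> E") simp_all
  qed
  then have "closed Z"
    unfolding Z_def by (intro closed_Collect_all)
  moreover have "bounded Z"
  proof (rule boundedI)
    fix z assume z: "z \<in> Z"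
    have "\<bar>z $ i $ j\<bar> \<le> 1" for i j
    proof -
      consider "(i, j) \<in> E" | "(j, i) \<in> E" | "(i, j) \<notin> E" "(j, i) \<notin> E" by blast
      then show ?thesis
      proof cases
        case 1
        then have "z $ i $ j \<in> Sgn (x $ i - x $ j)"
          using Z[OF z, of i j] by simp
        then show ?thesis using Sgn_cases by blast
      next
        case 2
        then have "z $ j $ i \<in> Sgn (x $ j - x $ i)" "z $ i $ j = - z $ j $ i"
          using Z[OF z, of j i] by (simp_all add: eq_neg_iff_add_eq_0)
        then show ?thesis using Sgn_cases by fastforce
      next
        case 3
        then have "z $ i $ j = 0"
          using Z[OF z, of i j] by simp
        then show ?thesis by simp
      qed
    qed
    then have "norm (z $ i) \<le> real CARD('a)" for i
      using norm_le_l1_cart[of "z $ i"] sum_mono[of UNIV "\<lambda>j. \<bar>z $ i $ j\<bar>" "\<lambda>_. 1"] by simp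
    moreover have "norm z \<le> (\<Sum>i\<in>UNIV. norm (z $ i))"
      unfolding norm_vec_def by (rule L2_set_le_sum) simp
    ultimately show "norm z \<le> (\<Sum>i\<in>(UNIV :: 'a set). real CARD('a))"
      by (meson order_trans sum_mono)
  qed
  ultimately have "compact Z"
    by (simp add: compact_eq_bounded_closed)
  moreover have "continuous_on Z (\<lambda>z. divergence E (\<lambda>i j. z $ i $ j))"
    unfolding divergence_def by (intro continuous_intros)
  moreover have "tv_subdiff E x = (\<lambda>z. divergence E (\<lambda>i j. z $ i $ j)) ` Z"
  proof (intro equalityI subsetI)
    fix p assume "p \<in> tv_subdiff E x"
    then obtain z where z: "z \<in> edge_flows E x" "p = divergence E z"
      by (auto simp: tv_subdiff_def)
    let ?z = "\<chi> i j. if (i, j) \<in> E \<or> (j, i) \<in> E then z i j else 0"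
    have "?z \<in> Z"
      using z(1) by (auto simp: Z_def edge_flows_def)
    moreover have "p = divergence E (\<lambda>i j. ?z $ i $ j)"
      by (simp add: z(2) divergence_def)
    ultimately show "p \<in> (\<lambda>z. divergence E (\<lambda>i j. z $ i $ j)) ` Z" by blast
  next
    fix p assume "p \<in> (\<lambda>z. divergence E (\<lambda>i j. z $ i $ j)) ` Z"
    then obtain z where z: "z \<in> Z" "p = divergence E (\<lambda>i j. z $ i $ j)" by blast
    have "(\<lambda>i j. z $ i $ j) \<in> edge_flows E x"
      unfolding edge_flows_def using Z[OF z(1)] by (auto simp: eq_neg_iff_add_eq_0 split: if_splits)
    then show "p \<in> tv_subdiff E x"
      unfolding z(2) tv_subdiff_def by (rule imageI)
  qed
  ultimately show ?thesis
    using compact_continuous_image by metis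
qed

text \<open>A compact and a closed convex set that are disjoint have a strictly separating
  hyperplane; its normal is the direction.\<close>

lemma descent_direction_exists:
  assumes "tv_subdiff E x \<inter> norm_subdiff E \<mu> x = {}"
  shows "\<exists>v. descent_direction E \<mu> x v"
proof -
  obtain a b where "\<And>p. p \<in> tv_subdiff E x \<Longrightarrow> a \<bullet> p < b" "\<And>q. q \<in> norm_subdiff E \<mu> x \<Longrightarrow> b < a \<bullet> q"
    using separating_hyperplane_compact_closed[OF convex_tv_subdiff[of E x] compact_tv_subdiff[of E x] _
        convex_norm_subdiff[of E \<mu> x] closed_norm_subdiff[of E \<mu> x] assms] tv_subdiff_nonempty[of E x] by blast
  then show ?thesis
    unfolding descent_direction_def by (intro exI[of _ a]) (force simp: inner_commute)
qed

lemma not_eigenvector_iff_descent: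
  assumes "x \<noteq> 0"
  shows "\<not> one_laplacian_eigenvector E \<mu> x \<longleftrightarrow> (\<exists>v. descent_direction E \<mu> x v)"
proof
  assume "\<exists>v. descent_direction E \<mu> x v"
  then show "\<not> one_laplacian_eigenvector E \<mu> x"
    unfolding one_laplacian_eigenvector_iff descent_direction_def by (auto simp: disjoint_iff)
qed (use assms descent_direction_exists in \<open>auto simp: one_laplacian_eigenvector_iff\<close>)

lemma subdiff_upper_semicontinuous:
  "\<forall>\<^sub>F y in nhds x. tv_subdiff E y \<subseteq> tv_subdiff E x \<and> norm_subdiff E \<mu> y \<subseteq> norm_subdiff E \<mu> x"
proof -
  have lim: "((\<lambda>y. y $ i) \<longlongrightarrow> x $ i) (nhds x)" for i
    by (intro tendsto_intros filterlim_ident)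
  have "\<forall>\<^sub>F y in nhds x. \<forall>i j. Sgn (y $ i - y $ j) \<subseteq> Sgn (x $ i - x $ j)"
    by (intro eventually_all_finite Sgn_subset_nhd tendsto_diff lim)
  moreover have "\<forall>\<^sub>F y in nhds x. \<forall>i. Sgn (y $ i) \<subseteq> Sgn (x $ i)"
    by (intro eventually_all_finite Sgn_subset_nhd lim)
  ultimately show ?thesis
  proof eventually_elim
    case (elim y)
    then have "edge_flows E y \<subseteq> edge_flows E x"
      unfolding edge_flows_def by blast
    then have "tv_subdiff E y \<subseteq> tv_subdiff E x"
      unfolding tv_subdiff_def by blast
    moreover have "norm_subdiff E \<mu> y \<subseteq> norm_subdiff E \<mu> x"
      using elim(2) unfolding norm_subdiff_def by blast
    ultimately show ?case ..
  qed
qed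

text \<open>The subgradient \<open>p\<close> is taken at the end point and \<open>q\<close> at the
  starting point. Then convexity bounds the growth of \<open>tv E\<close> from above by
  \<open>t * (p \<bullet> v)\<close> and that of the norm term from below by
  \<open>t * (q \<bullet> v)\<close>, with no error term in \<open>t\<close>.\<close>

lemma descent_step:
  assumes "sym E" "0 \<le> \<mu>" "0 < t"
    and "p \<in> tv_subdiff E (x + t *\<^sub>R v)" "q \<in> norm_subdiff E \<mu> x" "p \<bullet> v < q \<bullet> v"
  shows "tv E (x + t *\<^sub>R v) - \<mu> * degree_norm E (x + t *\<^sub>R v) < tv E x - \<mu> * degree_norm E x"
proof -
  have "tv E (x + t *\<^sub>R v) = p \<bullet> x + t * (p \<bullet> v)"
    using tv_subdiff_inner_self[OF assms(1,4)] by (simp add: inner_add_right)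
  moreover have "p \<bullet> x \<le> tv E x"
    by (rule tv_subdiff_inner_le[OF assms(1,4)])
  moreover have "\<mu> * degree_norm E x + t * (q \<bullet> v) \<le> \<mu> * degree_norm E (x + t *\<^sub>R v)"
    using norm_subdiff_inner_le[OF assms(2,5), of "x + t *\<^sub>R v"] norm_subdiff_inner_self[OF assms(5)]
    by (simp add: inner_add_right)
  moreover have "t * (p \<bullet> v) < t * (q \<bullet> v)"
    using assms(3,6) by simp
  ultimately show ?thesis by linarith
qed

section \<open>The degree norm, its unit sphere and the eigenset\<close>

lemma vertex_degree_pos:
  fixes E :: "('n::finite) rel"
  assumes "CARD('n) \<ge> 2" "connected_graph E"
  shows "0 < vertex_degree E i"
proof -
  have "\<not> (UNIV :: 'n set) \<subseteq> {i}"
    using assms(1) card_mono[of "{i}" UNIV] by auto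
  then obtain j where "j \<noteq> i" by blast
  moreover have "(i, j) \<in> E\<^sup>*"
    using assms(2) by (simp add: connected_graph_def)
  ultimately obtain k where "(i, k) \<in> E"
    by (metis converse_rtranclE)
  then show ?thesis
    unfolding vertex_degree_def by (auto simp: card_gt_0_iff)
qed

lemma degree_norm_pos:
  fixes E :: "('n::finite) rel"
  assumes "CARD('n) \<ge> 2" "connected_graph E" "x \<noteq> 0"
  shows "0 < degree_norm E x"
proof -
  obtain i where "x $ i \<noteq> 0" using assms(3) by (auto simp: vec_eq_iff)
  then have "0 < real (vertex_degree E i) * \<bar>x $ i\<bar>"
    using vertex_degree_pos[OF assms(1,2)] by simp
  then show ?thesis
    unfolding degree_norm_def by (intro sum_pos2[of UNIV i]) auto
qed

lemma X_set_iff: "x \<in> X_set E \<longleftrightarrow> degree_norm E x = 1"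
  by (simp add: X_set_def degree_norm_def)

lemma degree_norm_0 [simp]: "degree_norm E 0 = 0"
  by (simp add: degree_norm_def)

lemma degree_norm_uminus [simp]: "degree_norm E (- x) = degree_norm E x"
  by (simp add: degree_norm_def)

lemma degree_norm_nonneg: "0 \<le> degree_norm E x"
  unfolding degree_norm_def by (intro sum_nonneg) simp

lemma degree_norm_scaleR: "0 \<le> c \<Longrightarrow> degree_norm E (c *\<^sub>R x) = c * degree_norm E x"
  by (simp add: degree_norm_def sum_distrib_left abs_mult mult_ac)

lemma tv_scaleR: "0 \<le> c \<Longrightarrow> tv E (c *\<^sub>R x) = c * tv E x"
proof -
  assume "0 \<le> c"
  then have "\<bar>c * x $ i - c * x $ j\<bar> = c * \<bar>x $ i - x $ j\<bar>" for i j
    by (simp add: abs_mult flip: right_diff_distrib)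
  then show ?thesis by (simp add: tv_def sum_distrib_left case_prod_unfold)
qed

lemma tv_nonneg: "0 \<le> tv E x"
  by (auto simp: tv_def intro!: sum_nonneg)

lemma continuous_on_degree_norm: "continuous_on S (degree_norm E)"
  unfolding degree_norm_def by (intro continuous_intros)

lemma continuous_on_tv: "continuous_on S (tv E)"
  unfolding tv_def case_prod_unfold by (intro continuous_intros) auto

lemma compact_X_set:
  fixes E :: "('n::finite) rel"
  assumes "CARD('n) \<ge> 2" "connected_graph E"
  shows "compact (X_set E)"
proof -
  have "X_set E = degree_norm E -` {1}"
    by (auto simp: X_set_iff)
  then have "closed (X_set E)"
    by (simp add: closed_vimage continuous_on_degree_norm)
  moreover have "bounded (X_set E)"
  proof (rule boundedI)
    fix x assume x: "x \<in> X_set E"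
    have "norm x \<le> (\<Sum>i\<in>UNIV. \<bar>x $ i\<bar>)" by (rule norm_le_l1_cart)
    also have "\<dots> \<le> degree_norm E x"
      unfolding degree_norm_def
    proof (rule sum_mono)
      fix i
      have "1 \<le> real (vertex_degree E i)"
        using vertex_degree_pos[OF assms, of i] by linarith
      then show "\<bar>x $ i\<bar> \<le> real (vertex_degree E i) * \<bar>x $ i\<bar>"
        by (simp add: mult_le_cancel_right1)
    qed
    finally show "norm x \<le> 1" using x by (simp add: X_set_iff)
  qed
  ultimately show ?thesis by (simp add: compact_eq_bounded_closed)
qed

text \<open>Off the eigenset a point of \<open>X_set E\<close> has a descent direction, and upper
  semicontinuity makes the same vector a descent direction at all nearby points.\<close>

lemma closed_eigenset:
  fixes E :: "('n::finite) rel"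
  assumes "CARD('n) \<ge> 2" "connected_graph E"
  shows "closed (eigenset E \<mu>)"
proof -
  have "open {x. \<exists>v. descent_direction E \<mu> x v}"
  proof (subst open_subopen, intro ballI)
    fix x assume "x \<in> {x. \<exists>v. descent_direction E \<mu> x v}"
    then obtain v where v: "descent_direction E \<mu> x v" by blast
    obtain U where U: "open U" "x \<in> U"
      "\<And>y. y \<in> U \<Longrightarrow> tv_subdiff E y \<subseteq> tv_subdiff E x \<and> norm_subdiff E \<mu> y \<subseteq> norm_subdiff E \<mu> x"
      using subdiff_upper_semicontinuous[of E x \<mu>] unfolding eventually_nhds by blast
    have "descent_direction E \<mu> y v" if "y \<in> U" for y
      using v U(3)[OF that] unfolding descent_direction_def by blast
    then show "\<exists>T. open T \<and> x \<in> T \<and> T \<subseteq> {x. \<exists>v. descent_direction E \<mu> x v}"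
      using U(1,2) by blast
  qed
  moreover have "eigenset E \<mu> = X_set E - {x. \<exists>v. descent_direction E \<mu> x v}"
  proof -
    have "one_laplacian_eigenvector E \<mu> x \<longleftrightarrow> \<not> (\<exists>v. descent_direction E \<mu> x v)" if "x \<in> X_set E" for x
    proof -
      have "x \<noteq> 0"
        using that by (auto simp: X_set_iff)
      then show ?thesis
        using not_eigenvector_iff_descent by blast
    qed
    then show ?thesis
      unfolding eigenset_def by blast
  qed
  ultimately show ?thesis
    using compact_X_set[OF assms] by (simp add: closed_Diff compact_imp_closed)
qed

lemma eigenset_uminus: "x \<in> eigenset E \<mu> \<Longrightarrow> - x \<in> eigenset E \<mu>"
proof -
  assume x: "x \<in> eigenset E \<mu>"
  then obtain p where "p \<in> tv_subdiff E x" "p \<in> norm_subdiff E \<mu> x" "x \<noteq> 0"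
    by (auto simp: eigenset_def one_laplacian_eigenvector_iff)
  then have "- p \<in> tv_subdiff E (- x)" "- p \<in> norm_subdiff E \<mu> (- x)" "- x \<noteq> 0"
    by (auto intro: tv_subdiff_uminus norm_subdiff_uminus)
  then show ?thesis
    using x by (auto simp: eigenset_def one_laplacian_eigenvector_iff X_set_iff)
qed

subsection \<open>Krasnoselskii genus\<close>

definition genus_map :: "(real ^ 'n::finite) set \<Rightarrow> nat \<Rightarrow> (real ^ 'n \<Rightarrow> nat \<Rightarrow> real) \<Rightarrow> bool" where
  "genus_map A m f \<longleftrightarrow> (\<forall>i. continuous_on A (\<lambda>x. f x i)) \<and> (\<forall>x\<in>A. \<forall>i\<ge>m. f x i = 0) \<and>
    (\<forall>x\<in>A. \<forall>i. f (- x) i = - f x i) \<and> (\<forall>x\<in>A. \<exists>i. f x i \<noteq> 0)"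

lemma continuous_map_Euclidean_space_componentwise:
  "continuous_map (top_of_set S) (Euclidean_space m) f \<longleftrightarrow>
    (\<forall>i. continuous_on S (\<lambda>x. f x i)) \<and> (\<forall>x\<in>S. \<forall>i\<ge>m. f x i = 0)"
  by (auto simp: Euclidean_space_def continuous_map_in_subtopology continuous_map_componentwise_UNIV)

lemma nsphere_eq_top_of_set: "nsphere n = top_of_set (topspace (nsphere n))"
  by (simp add: nsphere euclidean_product_topology)

lemma genus_eq_Least: "genus A = (LEAST m. \<exists>f. genus_map A m f)"
  unfolding genus_def genus_map_def continuous_map_Euclidean_space_componentwise fun_eq_iff conj_assoc
  by simp

lemma genus_le: "genus_map A m f \<Longrightarrow> genus A \<le> m"
  unfolding genus_eq_Least by (intro Least_le exI)

lemma genus_attained: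
  fixes A :: "(real ^ 'n::finite) set"
  assumes "0 \<notin> A"
  shows "\<exists>f. genus_map A (genus A) f"
proof -
  obtain h where h: "bij_betw h {0..<CARD('n)} (UNIV :: 'n set)"
    using ex_bij_betw_nat_finite[of "UNIV :: 'n set"] by auto
  define f where "f x i = (if i < CARD('n) then x $ h i else 0)" for x :: "real ^ 'n" and i
  have "\<exists>i. f x i \<noteq> 0" if "x \<in> A" for x
  proof -
    have "x \<noteq> 0" using that assms by blast
    then obtain j where j: "x $ j \<noteq> 0" by (auto simp: vec_eq_iff)
    have "j \<in> h ` {0..<CARD('n)}"
      using bij_betw_imp_surj_on[OF h] by simp
    then obtain i where "i < CARD('n)" "h i = j" by auto
    with j have "f x i \<noteq> 0" by (simp add: f_def)
    then show ?thesis ..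
  qed
  moreover have "continuous_on A (\<lambda>x. f x i)" for i
    unfolding f_def by (cases "i < CARD('n)") (auto intro!: continuous_intros)
  ultimately have "genus_map A CARD('n) f"
    unfolding genus_map_def by (simp add: f_def)
  then have "\<exists>m f. genus_map A m f" by blast
  then show ?thesis
    unfolding genus_eq_Least by (rule LeastI_ex)
qed

lemma genus_empty [simp]: "genus {} = 0"
  using genus_le[of "{}" 0 "\<lambda>_ _. 0"] by (simp add: genus_map_def)

lemma genus_image:
  assumes "0 \<notin> \<eta> ` A" "continuous_on A \<eta>" "\<And>x. x \<in> A \<Longrightarrow> \<eta> (- x) = - \<eta> x"
  shows "genus A \<le> genus (\<eta> ` A)"
proof -
  obtain f where f: "genus_map (\<eta> ` A) (genus (\<eta> ` A)) f"
    using genus_attained[OF assms(1)] by blast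
  have "continuous_on A (\<lambda>x. f (\<eta> x) i)" for i
    using f assms(2) continuous_on_compose2[of "\<eta> ` A" "\<lambda>y. f y i" A \<eta>]
    by (simp add: genus_map_def)
  then have "genus_map A (genus (\<eta> ` A)) (\<lambda>x. f (\<eta> x))"
    using f assms(3) by (simp add: genus_map_def)
  then show ?thesis by (rule genus_le)
qed

text \<open>The odd part of a Tietze extension is still an extension, because \<open>g\<close> is
  already odd on the symmetric set \<open>A\<close>.\<close>

lemma odd_real_extension:
  fixes g :: "real ^ 'n::finite \<Rightarrow> real"
  assumes "closed A" "\<And>x. x \<in> A \<Longrightarrow> - x \<in> A" "continuous_on A g" "\<And>x. x \<in> A \<Longrightarrow> g (- x) = - g x"
  shows "\<exists>G. continuous_on UNIV G \<and> (\<forall>x. G (- x) = - G x) \<and> (\<forall>x\<in>A. G x = g x)"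
proof -
  obtain h where h: "continuous_on UNIV h" "\<And>x. x \<in> A \<Longrightarrow> h x = g x"
  proof (rule Tietze_unbounded[OF assms(3), of UNIV])
    show "closedin (top_of_set UNIV) A" by (rule closed_subset[OF subset_UNIV assms(1)])
  qed (rule that)
  have "continuous_on UNIV (\<lambda>x. (h x - h (- x)) / 2)"
    by (intro continuous_intros continuous_on_compose2[OF h(1)]) auto
  moreover have "(h x - h (- x)) / 2 = g x" if "x \<in> A" for x
    using that assms(2,4) by (simp add: h(2))
  ultimately show ?thesis
    by (intro exI[of _ "\<lambda>x. (h x - h (- x)) / 2"] conjI allI ballI) (simp_all add: field_simps)
qed

lemma genus_map_extension:
  assumes "closed A" "\<And>x. x \<in> A \<Longrightarrow> - x \<in> A" "genus_map A m f"
  obtains F where "\<And>i. continuous_on UNIV (\<lambda>x. F x i)" "\<And>x i. F (- x) i = - F x i"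
    "\<And>x i. m \<le> i \<Longrightarrow> F x i = 0" "\<And>x. x \<in> A \<Longrightarrow> F x = f x"
proof -
  have "\<exists>G. continuous_on UNIV G \<and> (\<forall>x. G (- x) = - G x) \<and> (\<forall>x\<in>A. G x = f x i)" for i
    using assms(3) by (intro odd_real_extension assms(1,2)) (auto simp: genus_map_def)
  then obtain G where G: "\<And>i. continuous_on UNIV (G i)" "\<And>i x. G i (- x) = - G i x"
    "\<And>i x. x \<in> A \<Longrightarrow> G i x = f x i"
    by metis
  let ?F = "\<lambda>x i. if i < m then G i x else 0"
  have "continuous_on UNIV (\<lambda>x. ?F x i)" for i
    by (cases "i < m") (auto intro: G(1))
  moreover have "?F x = f x" if "x \<in> A" for x
    using assms(3) that by (auto simp: fun_eq_iff G(3) genus_map_def)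
  ultimately show ?thesis
    by (intro that[of ?F]) (auto simp: G(2))
qed

text \<open>The \<open>r\<close> components of \<open>F\<close> and an odd nonvanishing map on the zero set of \<open>F\<close>, extended to the whole
  space, combine to an odd map of the sphere, which Borsuk-Ulam forces to vanish if its target is too small.\<close>

lemma genus_zero_set:
  fixes A :: "(real ^ 'n::finite) set" and F :: "real ^ 'n \<Rightarrow> nat \<Rightarrow> real"
  assumes "closed A" "\<And>x. x \<in> A \<Longrightarrow> - x \<in> A" "0 \<notin> A"
    and h: "continuous_on (topspace (nsphere n)) h" "h ` topspace (nsphere n) \<subseteq> A"
      "\<And>y. y \<in> topspace (nsphere n) \<Longrightarrow> h (antipode y) = - h y"
    and F: "\<And>i. continuous_on UNIV (\<lambda>x. F x i)" "\<And>x i. F (- x) i = - F x i" "\<And>x i. r \<le> i \<Longrightarrow> F x i = 0"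
  shows "n < r + genus {x \<in> A. F x = (\<lambda>i. 0)}"
proof (rule ccontr)
  let ?B = "{x \<in> A. F x = (\<lambda>i. 0)}"
  let ?s = "genus ?B"
  assume "\<not> ?thesis"
  then have le: "r + ?s \<le> n" by simp
  have "closed {x. \<forall>i. F x i = 0}"
    by (intro closed_Collect_all closed_Collect_eq F(1) continuous_on_const)
  then have "closed (A \<inter> {x. \<forall>i. F x i = 0})"
    using assms(1) by (rule closed_Int[rotated])
  also have "A \<inter> {x. \<forall>i. F x i = 0} = ?B"
    by (auto simp: fun_eq_iff)
  finally have "closed ?B" .
  moreover have "- x \<in> ?B" if "x \<in> ?B" for x
    using that assms(2) F(2)[of x] by (auto simp: fun_eq_iff)
  moreover obtain g where g: "genus_map ?B ?s g"
    using genus_attained[of ?B] assms(3) by auto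
  ultimately obtain G where G: "\<And>i. continuous_on UNIV (\<lambda>x. G x i)" "\<And>x i. G (- x) i = - G x i"
    "\<And>x i. ?s \<le> i \<Longrightarrow> G x i = 0" "\<And>x. x \<in> ?B \<Longrightarrow> G x = g x"
    using genus_map_extension[of ?B ?s g] by blast
  \<comment> \<open>The first \<open>r\<close> coordinates are those of \<open>F\<close>, the next
    \<open>?s\<close> those of \<open>G\<close>. As \<open>r + ?s \<le> n\<close>, the target is
    \<open>Euclidean_space n\<close>, one dimension below the ambient space of
    \<open>nsphere n\<close>.\<close>
  let ?f = "\<lambda>y i. if i < r then F (h y) i else G (h y) (i - r)"
  have "continuous_on (topspace (nsphere n)) (\<lambda>y. ?f y i)" for i
    by (cases "i < r") (auto intro: continuous_on_compose2[OF F(1) h(1)] continuous_on_compose2[OF G(1) h(1)])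
  moreover have "?f y i = 0" if "n \<le> i" for y i
    using that le by (auto intro: G(3))
  ultimately have "continuous_map (nsphere n) (Euclidean_space n) ?f"
    by (subst nsphere_eq_top_of_set) (simp add: continuous_map_Euclidean_space_componentwise)
  moreover have "?f (antipode y) = antipode (?f y)" if "y \<in> topspace (nsphere n)" for y
    by (simp add: h(3)[OF that] F(2) G(2) fun_eq_iff)
  ultimately obtain y where y: "y \<in> topspace (nsphere n)" "?f y = (\<lambda>i. 0)"
    using Borsuk_Ulam[of n ?f] by blast
  have f0: "?f y i = 0" for i
    using y(2) by (rule fun_cong)
  have "F (h y) i = 0" for i
    using f0[of i] F(3)[of i] by (cases "i < r") auto
  then have hB: "h y \<in> ?B"
    using h(2) y(1) by auto
  then obtain i where "g (h y) i \<noteq> 0"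
    using g unfolding genus_map_def by blast
  moreover have "G (h y) i = 0" for i
    using f0[of "i + r"] by simp
  ultimately show False
    using G(4)[OF hB] by simp
qed

subsection \<open>Deformation below a level without eigenvectors\<close>

text \<open>The deformation moves every point along a finite combination of descent directions chosen at
  nearby points; the descent cones are convex, odd and can only grow near a point.\<close>

lemma odd_descent_step:
  fixes A :: "(real ^ 'n::finite) set"
  assumes "compact A" "\<And>x. x \<in> A \<Longrightarrow> - x \<in> A"
    and desc: "\<And>x. x \<in> A \<Longrightarrow> \<exists>v. descent_direction E \<mu> x v"
  obtains t v where "0 < t" "continuous_on UNIV v" "\<And>x. v (- x) = - v x"
    "\<And>y p q. y \<in> A \<Longrightarrow> p \<in> tv_subdiff E (y + t *\<^sub>R v y) \<Longrightarrow> q \<in> norm_subdiff E \<mu> y \<Longrightarrow> p \<bullet> v y < q \<bullet> v y"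
proof -
  have "\<exists>v \<epsilon>. \<epsilon> > 0 \<and> descent_direction E \<mu> x v \<and>
      (\<forall>y. dist y x < 2 * \<epsilon> \<longrightarrow> tv_subdiff E y \<subseteq> tv_subdiff E x \<and> norm_subdiff E \<mu> y \<subseteq> norm_subdiff E \<mu> x)"
    if x: "x \<in> A" for x
  proof -
    obtain v where v: "descent_direction E \<mu> x v" using desc[OF x] by blast
    obtain d where "d > 0" "\<forall>y. dist y x < d \<longrightarrow> tv_subdiff E y \<subseteq> tv_subdiff E x \<and> norm_subdiff E \<mu> y \<subseteq> norm_subdiff E \<mu> x"
      using subdiff_upper_semicontinuous[of E x \<mu>] unfolding eventually_nhds_metric by blast
    then show ?thesis
      using v by (intro exI[of _ v] exI[of _ "d / 2"]) simp
  qed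
  \<comment> \<open>The factor 2 leaves one \<open>\<epsilon> x\<close> for the distance from
    \<open>y\<close> to the centre \<open>x\<close> and another for the displacement
    \<open>t *\<^sub>R v y\<close>.\<close>
  then obtain w \<epsilon> where \<epsilon>: "\<And>x. x \<in> A \<Longrightarrow> \<epsilon> x > 0" and w: "\<And>x. x \<in> A \<Longrightarrow> descent_direction E \<mu> x (w x)"
    and near: "\<And>x y. x \<in> A \<Longrightarrow> dist y x < 2 * \<epsilon> x \<Longrightarrow> tv_subdiff E y \<subseteq> tv_subdiff E x"
      "\<And>x y. x \<in> A \<Longrightarrow> dist y x < 2 * \<epsilon> x \<Longrightarrow> norm_subdiff E \<mu> y \<subseteq> norm_subdiff E \<mu> x"
    by metis
  obtain D where D: "finite D" "D \<subseteq> A" "A \<subseteq> (\<Union>x\<in>D. ball x (\<epsilon> x))"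
  proof (rule compactE_image[OF assms(1), of A "\<lambda>x. ball x (\<epsilon> x)"])
    show "A \<subseteq> (\<Union>x\<in>A. ball x (\<epsilon> x))" using \<epsilon> by force
  qed (auto intro: that)
  \<comment> \<open>\<open>a x\<close> is a tent function supported in the ball around
    \<open>x\<close>. Subtracting its mirror image makes \<open>v\<close> odd, and is harmless
    because \<open>- w x\<close> is a descent direction at \<open>- x\<close>.\<close>
  define a where "a x y = max 0 (\<epsilon> x - dist y x)" for x y
  define v where "v y = (\<Sum>x\<in>D. (a x y - a x (- y)) *\<^sub>R w x)" for y
  have a: "0 \<le> a x y" "a x y \<le> \<epsilon> x" "a x y \<noteq> 0 \<Longrightarrow> dist y x < \<epsilon> x" if "x \<in> D" for x y
    using \<epsilon>[of x] that D(2) by (auto simp: a_def max_def split: if_splits)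
  have cont: "continuous_on UNIV v"
    unfolding v_def a_def by (intro continuous_intros)
  have odd: "v (- y) = - v y" for y
    unfolding v_def sum_negf[symmetric] by (intro sum.cong refl) (simp add: scaleR_left_diff_distrib)
  define M where "M = (\<Sum>x\<in>D. \<epsilon> x * norm (w x)) + 1"
  have bound: "norm (v y) < M" for y
  proof -
    have "norm (v y) \<le> (\<Sum>x\<in>D. norm ((a x y - a x (- y)) *\<^sub>R w x))"
      unfolding v_def by (rule norm_sum)
    also have "\<dots> \<le> (\<Sum>x\<in>D. \<epsilon> x * norm (w x))"
    proof (rule sum_mono)
      fix x assume x: "x \<in> D"
      have "\<bar>a x y - a x (- y)\<bar> \<le> \<epsilon> x"
        using a(1,2)[OF x, of y] a(1,2)[OF x, of "- y"] by linarith
      then show "norm ((a x y - a x (- y)) *\<^sub>R w x) \<le> \<epsilon> x * norm (w x)"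
        by (simp add: mult_right_mono)
    qed
    finally show ?thesis by (simp add: M_def)
  qed
  have "0 < M" using bound[of 0] norm_ge_zero le_less_trans by blast
  \<comment> \<open>The inserted 1 covers an empty \<open>D\<close>; likewise the summand 1 in
    \<open>M\<close> keeps \<open>M\<close> positive.\<close>
  define e where "e = Min (insert 1 (\<epsilon> ` D))"
  have e: "0 < e" "\<And>x. x \<in> D \<Longrightarrow> e \<le> \<epsilon> x"
    using D(1,2) \<epsilon> by (auto simp: e_def)
  define t where "t = e / M"
  have t: "0 < t" using e \<open>0 < M\<close> by (simp add: t_def)
  have step: "norm (t *\<^sub>R v y) \<le> \<epsilon> x" if "x \<in> D" for x y
  proof -
    have "norm (t *\<^sub>R v y) \<le> t * M"
      using bound[of y] t by simp
    also have "\<dots> = e" using \<open>0 < M\<close> by (simp add: t_def)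
    finally show ?thesis using e(2)[OF that] by linarith
  qed
  have "p \<bullet> v y < q \<bullet> v y"
    if y: "y \<in> A" and p: "p \<in> tv_subdiff E (y + t *\<^sub>R v y)" and q: "q \<in> norm_subdiff E \<mu> y" for y p q
  proof -
    let ?y = "y + t *\<^sub>R v y"
    have less: "p \<bullet> w x < q \<bullet> w x" if x: "x \<in> D" and ax: "a x y \<noteq> 0" for x
    proof -
      have xA: "x \<in> A" using x D(2) by blast
      have "dist y x < \<epsilon> x" using a(3)[OF x ax] .
      moreover have "dist ?y x \<le> dist y x + norm (t *\<^sub>R v y)"
        using dist_triangle[of ?y x y] by (simp add: dist_norm)
      ultimately have "dist ?y x < 2 * \<epsilon> x" "dist y x < 2 * \<epsilon> x"
        using step[OF x, of y] \<epsilon>[OF xA] by linarith+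
      then have "p \<in> tv_subdiff E x" "q \<in> norm_subdiff E \<mu> x"
        using near[OF xA] p q by blast+
      then show ?thesis
        using w[OF xA] unfolding descent_direction_def by blast
    qed
    have greater: "q \<bullet> w x < p \<bullet> w x" if x: "x \<in> D" and ax: "a x (- y) \<noteq> 0" for x
    proof -
      have xA: "x \<in> A" using x D(2) by blast
      have "dist (- y) x < \<epsilon> x" using a(3)[OF x ax] .
      moreover have "dist (- ?y) x \<le> dist (- y) x + norm (t *\<^sub>R v y)"
        using dist_triangle[of "- ?y" x "- y"] by (simp add: dist_norm norm_minus_commute)
      ultimately have "dist (- ?y) x < 2 * \<epsilon> x" "dist (- y) x < 2 * \<epsilon> x"
        using step[OF x, of y] \<epsilon>[OF xA] by linarith+
      moreover have "- p \<in> tv_subdiff E (- ?y)" "- q \<in> norm_subdiff E \<mu> (- y)"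
        by (rule tv_subdiff_uminus[OF p], rule norm_subdiff_uminus[OF q])
      ultimately have "- p \<in> tv_subdiff E x" "- q \<in> norm_subdiff E \<mu> x"
        using near[OF xA] by blast+
      then have "- p \<bullet> w x < - q \<bullet> w x"
        using w[OF xA] unfolding descent_direction_def by blast
      then show ?thesis by simp
    qed
    have nonneg1: "0 \<le> a x y * (q \<bullet> w x - p \<bullet> w x)" if "x \<in> D" for x
    proof (cases "a x y = 0")
      case False
      show ?thesis
        using less[OF that False] by (intro mult_nonneg_nonneg a(1)[OF that]) simp
    qed simp
    have nonneg2: "0 \<le> a x (- y) * (p \<bullet> w x - q \<bullet> w x)" if "x \<in> D" for x
    proof (cases "a x (- y) = 0")
      case False
      show ?thesis
        using greater[OF that False] by (intro mult_nonneg_nonneg a(1)[OF that]) simp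
    qed simp
    \<comment> \<open>All summands are nonnegative; the centre of a ball containing \<open>y\<close>
      supplies a strictly positive one.\<close>
    obtain x0 where x0: "x0 \<in> D" "dist x0 y < \<epsilon> x0"
      using D(3) y by auto
    then have "a x0 y > 0"
      by (simp add: a_def dist_commute)
    have "0 < (\<Sum>x\<in>D. a x y * (q \<bullet> w x - p \<bullet> w x) + a x (- y) * (p \<bullet> w x - q \<bullet> w x))"
    proof (rule sum_pos2[OF D(1) x0(1)])
      have "0 < a x0 y * (q \<bullet> w x0 - p \<bullet> w x0)"
        using less[OF x0(1)] \<open>a x0 y > 0\<close> by simp
      then show "0 < a x0 y * (q \<bullet> w x0 - p \<bullet> w x0) + a x0 (- y) * (p \<bullet> w x0 - q \<bullet> w x0)"
        using nonneg2[OF x0(1)] by linarith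
    qed (intro add_nonneg_nonneg nonneg1 nonneg2)
    also have "\<dots> = (\<Sum>x\<in>D. (a x y - a x (- y)) * (q \<bullet> w x) - (a x y - a x (- y)) * (p \<bullet> w x))"
      by (intro sum.cong refl) (simp add: algebra_simps)
    also have "\<dots> = q \<bullet> v y - p \<bullet> v y"
      by (simp add: v_def inner_sum_right sum_subtractf)
    finally show ?thesis by simp
  qed
  then show ?thesis
    using that[OF t cont odd] by blast
qed

text \<open>A single step along \<open>v\<close> suffices, followed by rescaling to
  \<open>X_set E\<close>. The strict inequality between \<open>tv E\<close> and \<open>\<mu>\<close>
  times the degree norm is invariant under positive scaling.\<close>

lemma deformation_below_level:
  fixes E :: "('n::finite) rel"
  assumes G: "CARD('n) \<ge> 2" "connected_graph E" and "0 \<le> \<mu>"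
    and A: "compact A" "\<And>x. x \<in> A \<Longrightarrow> - x \<in> A" "A \<subseteq> X_set E" "\<And>x. x \<in> A \<Longrightarrow> tv E x \<le> \<mu>"
      "A \<inter> eigenset E \<mu> = {}"
  obtains \<eta> where "continuous_on A \<eta>" "\<And>x. x \<in> A \<Longrightarrow> \<eta> (- x) = - \<eta> x"
    "\<And>x. x \<in> A \<Longrightarrow> \<eta> x \<in> X_set E" "\<And>x. x \<in> A \<Longrightarrow> tv E (\<eta> x) < \<mu>"
proof -
  have sym: "sym E" using G(2) by (simp add: connected_graph_def)
  have "\<exists>v. descent_direction E \<mu> x v" if "x \<in> A" for x
  proof -
    have "x \<noteq> 0" using that A(3) by (auto simp: X_set_iff)
    moreover have "\<not> one_laplacian_eigenvector E \<mu> x"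
      using that A(3,5) by (auto simp: eigenset_def)
    ultimately show ?thesis using not_eigenvector_iff_descent by blast
  qed
  then obtain t v where t: "0 < t" and v: "continuous_on UNIV v" "\<And>x. v (- x) = - v x"
    and desc: "\<And>y p q. y \<in> A \<Longrightarrow> p \<in> tv_subdiff E (y + t *\<^sub>R v y) \<Longrightarrow> q \<in> norm_subdiff E \<mu> y \<Longrightarrow> p \<bullet> v y < q \<bullet> v y"
    using odd_descent_step[OF A(1,2), of E \<mu>] by blast
  define u where "u x = x + t *\<^sub>R v x" for x
  have below: "tv E (u x) < \<mu> * degree_norm E (u x)" if x: "x \<in> A" for x
  proof -
    obtain p q where "p \<in> tv_subdiff E (u x)" "q \<in> norm_subdiff E \<mu> x"
      using tv_subdiff_nonempty norm_subdiff_nonempty by blast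
    then have "tv E (u x) - \<mu> * degree_norm E (u x) < tv E x - \<mu> * degree_norm E x"
      using desc[OF x] unfolding u_def by (intro descent_step[OF sym assms(3) t]) auto
    moreover have "degree_norm E x = 1" "tv E x \<le> \<mu>"
      using x A(3,4) by (auto simp: X_set_iff)
    ultimately show ?thesis by simp
  qed
  \<comment> \<open>The moved point cannot be 0, since there the strict inequality
    \<open>below\<close> would read 0 < 0.\<close>
  have pos: "0 < degree_norm E (u x)" if "x \<in> A" for x
  proof -
    have "0 < \<mu> * degree_norm E (u x)"
      using below[OF that] tv_nonneg[of E "u x"] by linarith
    then show ?thesis
      using assms(3) degree_norm_nonneg[of E "u x"] by (simp add: zero_less_mult_iff)
  qed
  show ?thesis
  proof (rule that[of "\<lambda>x. inverse (degree_norm E (u x)) *\<^sub>R u x"])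
    have "continuous_on A u"
      unfolding u_def using v(1) by (intro continuous_intros continuous_on_subset[OF v(1)]) auto
    moreover then have "continuous_on A (\<lambda>x. degree_norm E (u x))"
      using continuous_on_compose2[OF continuous_on_degree_norm[of UNIV E]] by blast
    ultimately show "continuous_on A (\<lambda>x. inverse (degree_norm E (u x)) *\<^sub>R u x)"
      using pos by (intro continuous_intros) force+
    fix x assume x: "x \<in> A"
    have "u (- x) = - u x"
      by (simp add: u_def v(2))
    then show "inverse (degree_norm E (u (- x))) *\<^sub>R u (- x) = - (inverse (degree_norm E (u x)) *\<^sub>R u x)"
      by simp
    show "inverse (degree_norm E (u x)) *\<^sub>R u x \<in> X_set E"
      using pos[OF x] by (simp add: X_set_iff degree_norm_scaleR)
    show "tv E (inverse (degree_norm E (u x)) *\<^sub>R u x) < \<mu>"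
      using pos[OF x] below[OF x] by (simp add: tv_scaleR field_simps)
  qed
qed

text \<open>Real infima and suprema need bounds: compactness of \<open>X_set E\<close> bounds
  \<open>tv E\<close> above, and \<open>1 \<le> k\<close> makes every admissible set nonempty, so
  each supremum is at least 0.\<close>

lemma minimax_le:
  fixes E :: "('n::finite) rel"
  assumes G: "CARD('n) \<ge> 2" "connected_graph E" and "1 \<le> k"
    and A: "closed_symmetric A" "A \<subseteq> X_set E" "k \<le> genus A" "\<And>x. x \<in> A \<Longrightarrow> tv E x \<le> b"
  shows "minimax E k \<le> b"
proof -
  have "bounded (tv E ` X_set E)"
    by (intro compact_imp_bounded compact_continuous_image compact_X_set G continuous_on_tv)
  then have bdd: "bdd_above (tv E ` B)" if "B \<subseteq> X_set E" for B
    using that by (meson bdd_above_mono bounded_imp_bdd_above image_mono)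
  have ne: "B \<noteq> {}" if "k \<le> genus B" for B :: "(real ^ 'n) set"
    using that assms(3) by auto
  have "0 \<le> (SUP x\<in>B. tv E x)" if B: "B \<subseteq> X_set E" "k \<le> genus B" for B
  proof -
    obtain x where "x \<in> B" using ne[OF B(2)] by blast
    then have "tv E x \<le> (SUP x\<in>B. tv E x)"
      using bdd[OF B(1)] by (rule cSUP_upper)
    then show ?thesis using tv_nonneg[of E x] by linarith
  qed
  then have "bdd_below ((\<lambda>A. SUP x\<in>A. tv E x) ` {A. closed_symmetric A \<and> A \<subseteq> X_set E \<and> k \<le> genus A})"
    by (intro bdd_belowI2[of _ 0]) blast
  then have "minimax E k \<le> (SUP x\<in>A. tv E x)"
    unfolding minimax_def using A by (intro cINF_lower) auto
  also have "\<dots> \<le> b"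
    using ne[OF A(3)] A(4) by (rule cSUP_least)
  finally show ?thesis .
qed

subsection \<open>Nodal domains\<close>

text \<open>The comparison vector is \<open>\<bar>x\<bar> sgn \<phi>\<close>: pairing it with the common subgradient at \<open>\<phi>\<close> gives
  exactly \<open>\<mu>\<close> times the degree norm of \<open>x\<close>, and edge by edge at least the variation of \<open>x\<close>.\<close>

lemma tv_le_of_nodal:
  fixes x \<phi> :: "real ^ 'n::finite"
  assumes sym: "sym E" and eig: "one_laplacian_eigenvector E \<mu> \<phi>"
    and zero: "\<And>i. \<phi> $ i = 0 \<Longrightarrow> x $ i = 0"
    and const: "\<And>i j. (i, j) \<in> E \<Longrightarrow> sgn (\<phi> $ i) = sgn (\<phi> $ j) \<Longrightarrow> \<phi> $ i \<noteq> 0 \<Longrightarrow> x $ i = x $ j"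
  shows "tv E x \<le> \<mu> * degree_norm E x"
proof -
  obtain z where z: "z \<in> edge_flows E \<phi>" and q: "divergence E z \<in> norm_subdiff E \<mu> \<phi>"
    using eig unfolding one_laplacian_eigenvector_iff tv_subdiff_def by blast
  define b where "b = (\<chi> i. \<bar>x $ i\<bar> * sgn (\<phi> $ i))"
  have "\<bar>x $ i - x $ j\<bar> \<le> z i j * (b $ i - b $ j)" if ij: "(i, j) \<in> E" for i j
  proof -
    have "z i j \<in> Sgn (\<phi> $ i - \<phi> $ j)" using z ij by (auto simp: edge_flows_def)
    \<comment> \<open>Endpoints of equal nonzero sign make both sides 0. For opposite signs
      \<open>z i j\<close> is 1 or -1 and the right-hand side is the sum of the two absolute values;
      if one entry of \<open>\<phi>\<close> is 0, only the other term remains.\<close>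
    then show ?thesis
      using const[OF ij] zero[of i] zero[of j]
      by (cases "\<phi> $ i" "0 :: real" rule: linorder_cases; cases "\<phi> $ j" "0 :: real" rule: linorder_cases)
        (auto simp: b_def Sgn_def split: if_splits)
  qed
  then have "(\<Sum>(i, j)\<in>E. \<bar>x $ i - x $ j\<bar>) \<le> (\<Sum>(i, j)\<in>E. z i j * (b $ i - b $ j))"
    by (intro sum_mono) auto
  then have "tv E x \<le> divergence E z \<bullet> b"
    unfolding divergence_inner[OF sym z] tv_def by simp
  also have "divergence E z \<bullet> b = \<mu> * degree_norm E x"
  proof -
    have "divergence E z $ i * b $ i = \<mu> * (real (vertex_degree E i) * \<bar>x $ i\<bar>)" for i
    proof -
      obtain s where s: "s \<in> Sgn (\<phi> $ i)" "divergence E z $ i = \<mu> * real (vertex_degree E i) * s"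
        using q unfolding norm_subdiff_def by blast
      have "s * b $ i = \<bar>x $ i\<bar>"
        using s(1) zero[of i] by (auto simp: b_def Sgn_def sgn_if split: if_splits)
      then show ?thesis by (simp add: s(2) mult.assoc)
    qed
    then show ?thesis
      unfolding inner_vec_def degree_norm_def sum_distrib_left by (intro sum.cong) auto
  qed
  finally show ?thesis .
qed

text \<open>One formula for both signs. At a zero of \<open>\<phi>\<close> it yields a component of
  the zero set, so such vertices are excluded wherever nodal domains are counted.\<close>

definition nodal_domain :: "('n::finite) rel \<Rightarrow> real ^ 'n \<Rightarrow> 'n \<Rightarrow> 'n set" where
  "nodal_domain E \<phi> v = (E \<inter> {i. sgn (\<phi> $ i) = sgn (\<phi> $ v)} \<times> {i. sgn (\<phi> $ i) = sgn (\<phi> $ v)})\<^sup>* `` {v}"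

lemma nodal_domains_eq: "nodal_domains E \<phi> = nodal_domain E \<phi> ` {v. \<phi> $ v \<noteq> 0}"
proof -
  have pos: "nodal_domain E \<phi> v = (E \<inter> {i. \<phi> $ i > 0} \<times> {i. \<phi> $ i > 0})\<^sup>* `` {v}" if "\<phi> $ v > 0" for v
  proof -
    have "{i. sgn (\<phi> $ i) = sgn (\<phi> $ v)} = {i. \<phi> $ i > 0}"
      using that by (auto simp: sgn_if)
    then show ?thesis by (simp only: nodal_domain_def)
  qed
  have neg: "nodal_domain E \<phi> v = (E \<inter> {i. \<phi> $ i < 0} \<times> {i. \<phi> $ i < 0})\<^sup>* `` {v}" if "\<phi> $ v < 0" for v
  proof -
    have "{i. sgn (\<phi> $ i) = sgn (\<phi> $ v)} = {i. \<phi> $ i < 0}"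
      using that by (auto simp: sgn_if)
    then show ?thesis by (simp only: nodal_domain_def)
  qed
  have "components_on E {i. \<phi> $ i > 0} = nodal_domain E \<phi> ` {v. \<phi> $ v > 0}"
    unfolding components_on_def setcompr_eq_image by (rule image_cong) (simp_all add: pos)
  moreover have "components_on E {i. \<phi> $ i < 0} = nodal_domain E \<phi> ` {v. \<phi> $ v < 0}"
    unfolding components_on_def setcompr_eq_image by (rule image_cong) (simp_all add: neg)
  moreover have "{v. \<phi> $ v \<noteq> 0} = {v. \<phi> $ v > 0} \<union> {v. \<phi> $ v < 0}"
    by auto
  ultimately show ?thesis
    unfolding nodal_domains_def by (simp only: image_Un)
qed

lemma nodal_domain_adjacent:
  assumes "sym E" "(i, j) \<in> E" "sgn (\<phi> $ i) = sgn (\<phi> $ j)"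
  shows "nodal_domain E \<phi> i = nodal_domain E \<phi> j"
proof -
  let ?W = "{l. sgn (\<phi> $ l) = sgn (\<phi> $ j)}"
  let ?R = "E \<inter> ?W \<times> ?W"
  have "(i, j) \<in> ?R" "(j, i) \<in> ?R"
    using assms by (auto dest: symD)
  then have "?R\<^sup>* `` {i} = ?R\<^sup>* `` {j}"
    by (auto intro: converse_rtrancl_into_rtrancl)
  then show ?thesis
    unfolding nodal_domain_def assms(3) .
qed

theorem theorem7:
  fixes E :: "('n::finite) rel" and \<phi> :: "real ^ 'n" and k r :: nat
  assumes "CARD('n) \<ge> 2"
    and "connected_graph E"
    and "1 \<le> k" and "k \<le> CARD('n)"
    and "one_laplacian_eigenvector E (minimax E k) \<phi>"
    and "r = genus (eigenset E (minimax E k))"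
  shows "card (nodal_domains E \<phi>) \<le> k + r - 1"
proof (rule ccontr)
  let ?c = "minimax E k" and ?K = "eigenset E (minimax E k)"
  note G = assms(1,2)
  have sym: "sym E" using assms(2) by (simp add: connected_graph_def)
  assume "\<not> ?thesis"
  \<comment> \<open>\<open>n\<close> is the dimension of the unit sphere of coefficient vectors, one
    coefficient per nodal domain. As \<open>1 \<le> k\<close>, the natural subtraction in the claim
    does not truncate.\<close>
  then obtain n where n: "card (nodal_domains E \<phi>) = Suc n" "k + r \<le> Suc n"
    using assms(3) by (cases "card (nodal_domains E \<phi>)") auto
  \<comment> \<open>Pairing a common subgradient with \<open>\<phi>\<close> gives
    \<open>tv E \<phi>\<close> on one side and \<open>?c\<close> times the degree norm on the
    other.\<close>
  have "0 \<le> ?c"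
  proof -
    obtain p where p: "p \<in> tv_subdiff E \<phi>" "p \<in> norm_subdiff E ?c \<phi>" "\<phi> \<noteq> 0"
      using assms(5) by (auto simp: one_laplacian_eigenvector_iff)
    then have "0 \<le> ?c * degree_norm E \<phi>"
      using tv_subdiff_inner_self[OF sym p(1)] norm_subdiff_inner_self[OF p(2)] tv_nonneg[of E \<phi>] by simp
    then show ?thesis
      using degree_norm_pos[OF G p(3)] by (simp add: zero_le_mult_iff)
  qed
  have "0 \<notin> ?K" by (simp add: eigenset_def X_set_iff)
  then obtain f where f: "genus_map ?K r f"
    using genus_attained[of ?K] assms(6) by blast
  obtain F where F: "\<And>i. continuous_on UNIV (\<lambda>x. F x i)" "\<And>x i. F (- x) i = - F x i"
    "\<And>x i. r \<le> i \<Longrightarrow> F x i = 0" and Ff: "\<And>x. x \<in> ?K \<Longrightarrow> F x = f x"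
    by (rule genus_map_extension[OF closed_eigenset[OF G] eigenset_uminus f]) blast+
  define A where "A = {x \<in> X_set E. tv E x \<le> ?c}"
  have A: "compact A" "\<And>x. x \<in> A \<Longrightarrow> - x \<in> A" "0 \<notin> A"
  proof -
    have "closed {x. tv E x \<le> ?c}"
      by (intro closed_Collect_le continuous_on_tv continuous_on_const)
    then have "compact (X_set E \<inter> {x. tv E x \<le> ?c})"
      using compact_X_set[OF G] by (rule compact_Int_closed[rotated])
    then show "compact A" by (simp add: A_def Int_def)
    show "- x \<in> A" if "x \<in> A" for x
      using that by (simp add: A_def X_set_iff tv_def abs_minus_commute)
    show "0 \<notin> A" by (simp add: A_def X_set_iff)
  qed
  define B where "B = {x \<in> A. F x = (\<lambda>i. 0)}"
  have "n < r + genus B"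
  proof -
    obtain e where e: "bij_betw e (nodal_domains E \<phi>) {0..<Suc n}"
      using ex_bij_betw_finite_nat[of "nodal_domains E \<phi>"] n(1) by auto
    \<comment> \<open>\<open>u\<close> spreads the coordinate numbered \<open>e V\<close> over the
      nodal domain \<open>V\<close>, identifying sphere points with piecewise constant
      vectors.\<close>
    define u where "u y = (\<chi> v. if \<phi> $ v = 0 then 0 else y (e (nodal_domain E \<phi> v)))" for y :: "nat \<Rightarrow> real"
    have le: "tv E (u y) \<le> ?c * degree_norm E (u y)" for y
    proof (rule tv_le_of_nodal[OF sym assms(5)])
      show "u y $ i = u y $ j" if "(i, j) \<in> E" "sgn (\<phi> $ i) = sgn (\<phi> $ j)" "\<phi> $ i \<noteq> 0" for i j
      proof -
        have "\<phi> $ j \<noteq> 0" using that(2,3) by (metis sgn_zero_iff)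
        then show ?thesis
          using nodal_domain_adjacent[OF sym that(1,2)] that(3) by (simp add: u_def)
      qed
    qed (simp add: u_def)
    have nz: "u y \<noteq> 0" if y: "y \<in> topspace (nsphere n)" for y
    proof -
      obtain l where l: "l \<le> n" "y l \<noteq> 0"
      proof -
        have "(\<Sum>i\<le>n. (y i)\<^sup>2) \<noteq> 0"
          using y by (simp add: nsphere)
        then obtain l where "l \<in> {..n}" "(y l)\<^sup>2 \<noteq> 0"
          by (rule sum.not_neutral_contains_not_neutral)
        then show ?thesis using that by simp
      qed
      have "l \<in> e ` nodal_domains E \<phi>"
        using bij_betw_imp_surj_on[OF e] l(1) by simp
      then obtain V where "V \<in> nodal_domains E \<phi>" "e V = l" by blast
      then obtain v where "\<phi> $ v \<noteq> 0" "e (nodal_domain E \<phi> v) = l"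
        by (auto simp: nodal_domains_eq)
      then have "u y $ v \<noteq> 0" using l(2) by (simp add: u_def)
      then show ?thesis by auto
    qed
    define h where "h y = inverse (degree_norm E (u y)) *\<^sub>R u y" for y
    have pos: "0 < degree_norm E (u y)" if "y \<in> topspace (nsphere n)" for y
      using degree_norm_pos[OF G nz[OF that]] .
    have cu: "continuous_on S u" for S
      unfolding u_def
    proof (rule continuous_on_vec_lambda)
      show "continuous_on S (\<lambda>y. if \<phi> $ v = 0 then 0 else y (e (nodal_domain E \<phi> v)))" for v
        using continuous_on_subset[OF continuous_on_product_coordinates subset_UNIV] by (cases "\<phi> $ v = 0") auto
    qed
    then have "continuous_on (topspace (nsphere n)) h"
      unfolding h_def using pos
      by (intro continuous_intros continuous_on_compose2[OF continuous_on_degree_norm[of UNIV E]]) force+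
    moreover have "h ` topspace (nsphere n) \<subseteq> A"
    proof (rule image_subsetI)
      fix y assume "y \<in> topspace (nsphere n)"
      then have "0 < degree_norm E (u y)" by (rule pos)
      moreover from this have "degree_norm E (h y) = 1" "tv E (h y) = tv E (u y) / degree_norm E (u y)"
        unfolding h_def by (simp_all add: degree_norm_scaleR tv_scaleR divide_inverse_commute)
      ultimately show "h y \<in> A"
        using le[of y] by (simp add: A_def X_set_iff pos_divide_le_eq)
    qed
    moreover have "h (antipode y) = - h y" for y
    proof -
      have "u (antipode y) = - u y" by (simp add: u_def vec_eq_iff)
      then show ?thesis by (simp add: h_def)
    qed
    ultimately show ?thesis
      unfolding B_def using A F(1-3) by (intro genus_zero_set) (auto simp: compact_imp_closed)
  qed
  then have kB: "k \<le> genus B" using n(2) by simp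
  have "closed {x. \<forall>i. F x i = 0}"
    by (intro closed_Collect_all closed_Collect_eq F(1) continuous_on_const)
  then have "compact (A \<inter> {x. \<forall>i. F x i = 0})"
    using A(1) by (rule compact_Int_closed[rotated])
  also have "A \<inter> {x. \<forall>i. F x i = 0} = B"
    by (auto simp: B_def fun_eq_iff)
  finally have B: "compact B" .
  have Bneg: "- x \<in> B" if "x \<in> B" for x
    using that A(2) F(2)[of x] by (auto simp: B_def fun_eq_iff)
  have BX: "B \<subseteq> X_set E" and Bc: "\<And>x. x \<in> B \<Longrightarrow> tv E x \<le> ?c"
    by (auto simp: B_def A_def)
  \<comment> \<open>On the eigenset \<open>F\<close> agrees with the nonvanishing \<open>f\<close>,
    so the zero set of \<open>F\<close> avoids it.\<close>
  have BK: "B \<inter> ?K = {}"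
  proof (rule equals0I)
    fix x assume "x \<in> B \<inter> ?K"
    then have "x \<in> ?K" "f x = (\<lambda>i. 0)"
      using Ff[of x] by (simp_all add: B_def)
    then show False
      using f unfolding genus_map_def by auto
  qed
  obtain \<eta> where \<eta>: "continuous_on B \<eta>" "\<And>x. x \<in> B \<Longrightarrow> \<eta> (- x) = - \<eta> x"
    "\<And>x. x \<in> B \<Longrightarrow> \<eta> x \<in> X_set E" "\<And>x. x \<in> B \<Longrightarrow> tv E (\<eta> x) < ?c"
    by (rule deformation_below_level[OF G \<open>0 \<le> ?c\<close> B Bneg BX Bc BK]) blast+
  let ?D = "\<eta> ` B"
  have D: "compact ?D" "?D \<subseteq> X_set E"
    using B \<eta>(1,3) by (auto intro: compact_continuous_image)
  have "uminus ` ?D = ?D"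
  proof -
    have "- \<eta> x \<in> ?D" if "x \<in> B" for x
      using imageI[OF Bneg[OF that], of \<eta>] \<eta>(2)[OF that] by simp
    then have sub: "uminus ` ?D \<subseteq> ?D" by blast
    then have "uminus ` uminus ` ?D \<subseteq> uminus ` ?D" by (rule image_mono)
    with sub show ?thesis by (simp add: image_image)
  qed
  then have "closed_symmetric ?D"
    using D(1) by (simp add: closed_symmetric_def compact_imp_closed)
  moreover have kD: "k \<le> genus ?D"
  proof -
    have "0 \<notin> ?D" using D(2) by (auto simp: X_set_iff)
    then show ?thesis using genus_image[OF _ \<eta>(1,2)] kB by fastforce
  qed
  \<comment> \<open>The maximum must be attained: pointwise strict bounds alone would allow the
    supremum to equal \<open>?c\<close>.\<close>
  moreover obtain d where d: "d \<in> ?D" "\<And>x. x \<in> ?D \<Longrightarrow> tv E x \<le> tv E d"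
  proof -
    have "?D \<noteq> {}" using kD assms(3) by auto
    then show ?thesis
      using continuous_attains_sup[OF D(1) _ continuous_on_tv[of ?D E]] that by blast
  qed
  ultimately have "?c \<le> tv E d"
    using minimax_le[OF G assms(3) _ D(2)] by blast
  moreover have "tv E d < ?c"
    using d(1) \<eta>(4) by blast
  ultimately show False by simp
qed

end
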